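(* Let $\Gamma$ be a countably infinite discrete group. If $(\mathcal{F}_n)_{n\in\mathbb{N}}$ is a sequence of unbounded families of finite subsets of $\Gamma$, then there exists a free subflow of $2^\Gamma$ that is $\mathcal{F}_n$-minimal for all $n\in\mathbb{N}$.
   Context: A $\Gamma$-flow is a nonempty compact Hausdorff space $X$ equipped with a continuous action of $\Gamma$; a subflow of $X$ is a nonempty closed $\Gamma$-invariant subset. A $\Gamma$-flow is free if $\gamma\cdot x\neq x$ for all points $x$ and all non-identity $\gamma\in\Gamma$. The space $2^\Gamma$ of all functions $x:\Gamma\to 2=\{0,1\}$ has the product topology ($2$ discrete) and the shift action $(\gamma\cdot x)(\delta)=x(\delta\gamma)$ for $\gamma,\delta\in\Gamma$. Given an action of $\Gamma$ on a set $X$ and a finite set $F\subset\Gamma$, a set $U\subseteq X$ is $F$-syndetic if $F^{-1}\cdot U=X$. For a family $\mathcal{F}$ of finite subsets of $\Gamma$, a $\Gamma$-flow $X$ is $\mathcal{F}$-minimal if for every nonempty open set $U\subseteq X$ there is $F\in\mathcal{F}$ such that $U$ is $F$-syndetic. A family $\mathcal{F}$ of finite sets is unbounded if $\sup_{F\in\mathcal{F}}|F|=\infty$. *)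

theory Defs
  imports
    "HOL-Analysis.Analysis"
    "HOL-Algebra.Group_Action"
    "HOL-Library.Extended_Nat"
begin

text \<open>
  The group carries the discrete topology. As for \<open>group_action\<close>, each map \<open>\<alpha> \<gamma>\<close> is
  extensional on the underlying space, i.e. takes the value \<open>undefined\<close> outside it.
\<close>

definition flow :: "('g, 'm) monoid_scheme \<Rightarrow> 'x topology \<Rightarrow> ('g \<Rightarrow> 'x \<Rightarrow> 'x) \<Rightarrow> bool" where
  "flow G X \<alpha> \<longleftrightarrow>
     topspace X \<noteq> {} \<and> compact_space X \<and> Hausdorff_space X \<and>
     group_action G (topspace X) \<alpha> \<and>
     continuous_map (prod_topology (discrete_topology (carrier G)) X) X (\<lambda>(\<gamma>, x). \<alpha> \<gamma> x)"

definition subflow ::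
  "('g, 'm) monoid_scheme \<Rightarrow> 'x topology \<Rightarrow> ('g \<Rightarrow> 'x \<Rightarrow> 'x) \<Rightarrow> 'x set \<Rightarrow> bool" where
  "subflow G X \<alpha> Y \<longleftrightarrow>
     flow G X \<alpha> \<and> Y \<noteq> {} \<and> closedin X Y \<and> (\<forall>\<gamma>\<in>carrier G. \<alpha> \<gamma> ` Y \<subseteq> Y)"

abbreviation restrict_action :: "('g \<Rightarrow> 'x \<Rightarrow> 'x) \<Rightarrow> 'x set \<Rightarrow> 'g \<Rightarrow> 'x \<Rightarrow> 'x" where
  "restrict_action \<alpha> Y \<equiv> \<lambda>\<gamma>. restrict (\<alpha> \<gamma>) Y"

definition free_flow :: "('g, 'm) monoid_scheme \<Rightarrow> 'x topology \<Rightarrow> ('g \<Rightarrow> 'x \<Rightarrow> 'x) \<Rightarrow> bool" where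
  "free_flow G X \<alpha> \<longleftrightarrow>
     flow G X \<alpha> \<and> (\<forall>x\<in>topspace X. \<forall>\<gamma>\<in>carrier G. \<gamma> \<noteq> \<one>\<^bsub>G\<^esub> \<longrightarrow> \<alpha> \<gamma> x \<noteq> x)"

text \<open>For an action \<open>\<alpha>\<close> of \<open>G\<close> on the set \<open>E\<close>.\<close>

definition syndetic ::
  "('g, 'm) monoid_scheme \<Rightarrow> 'x set \<Rightarrow> ('g \<Rightarrow> 'x \<Rightarrow> 'x) \<Rightarrow> 'g set \<Rightarrow> 'x set \<Rightarrow> bool" where
  "syndetic G E \<alpha> F U \<longleftrightarrow> (\<Union>\<gamma>\<in>F. \<alpha> (inv\<^bsub>G\<^esub> \<gamma>) ` U) = E"

definition family_minimal ::
  "('g, 'm) monoid_scheme \<Rightarrow> 'x topology \<Rightarrow> ('g \<Rightarrow> 'x \<Rightarrow> 'x) \<Rightarrow> 'g set set \<Rightarrow> bool" where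
  "family_minimal G X \<alpha> \<F> \<longleftrightarrow>
     flow G X \<alpha> \<and>
     (\<forall>U. openin X U \<and> U \<noteq> {} \<longrightarrow> (\<exists>F\<in>\<F>. syndetic G (topspace X) \<alpha> F U))"

definition unbounded_family :: "'g set set \<Rightarrow> bool" where
  "unbounded_family \<F> \<longleftrightarrow> (SUP F\<in>\<F>. enat (card F)) = \<infinity>"

text \<open>The type \<open>bool\<close> plays the role of \<open>2 = {0, 1}\<close>; the points of the shift space are the
  extensional functions on \<open>carrier G\<close>.\<close>

definition shift_space :: "('g, 'm) monoid_scheme \<Rightarrow> ('g \<Rightarrow> bool) topology" where
  "shift_space G = product_topology (\<lambda>_. discrete_topology UNIV) (carrier G)"

definition shift_action ::
  "('g, 'm) monoid_scheme \<Rightarrow> 'g \<Rightarrow> ('g \<Rightarrow> bool) \<Rightarrow> ('g \<Rightarrow> bool)" where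
  "shift_action G \<gamma> = (\<lambda>x\<in>topspace (shift_space G). \<lambda>\<delta>\<in>carrier G. x (\<delta> \<otimes>\<^bsub>G\<^esub> \<gamma>))"


lemma group_actionI:
  assumes G: "group G"
    and ext: "\<And>g. g \<in> carrier G \<Longrightarrow> \<phi> g \<in> extensional E"
    and cl: "\<And>g x. g \<in> carrier G \<Longrightarrow> x \<in> E \<Longrightarrow> \<phi> g x \<in> E"
    and one: "\<And>x. x \<in> E \<Longrightarrow> \<phi> \<one>\<^bsub>G\<^esub> x = x"
    and mult: "\<And>g h x. g \<in> carrier G \<Longrightarrow> h \<in> carrier G \<Longrightarrow> x \<in> E \<Longrightarrow>
                 \<phi> (g \<otimes>\<^bsub>G\<^esub> h) x = \<phi> g (\<phi> h x)"
  shows "group_action G E \<phi>"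
proof -
  interpret group G by (fact G)
  have bij: "\<phi> g \<in> Bij E" if g: "g \<in> carrier G" for g
  proof -
    have "bij_betw (\<phi> g) E E"
    proof (rule bij_betw_byWitness[where f' = "\<phi> (inv\<^bsub>G\<^esub> g)"])
      show "\<forall>x\<in>E. \<phi> (inv\<^bsub>G\<^esub> g) (\<phi> g x) = x" "\<forall>x\<in>E. \<phi> g (\<phi> (inv\<^bsub>G\<^esub> g) x) = x"
        using g by (simp_all add: mult[symmetric] one)
    qed (use g cl in auto)
    then show ?thesis
      using ext[OF g] by (simp add: Bij_def)
  qed
  have "\<phi> (g \<otimes>\<^bsub>G\<^esub> h) = compose E (\<phi> g) (\<phi> h)" if "g \<in> carrier G" "h \<in> carrier G" for g h
    using that by (intro extensionalityI[OF ext]) (auto simp: compose_eq mult)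
  then have "\<phi> \<in> hom G (BijGroup E)"
    using bij by (auto simp: hom_def BijGroup_def)
  then show ?thesis
    by (simp add: group_action_def group_hom_def group_hom_axioms_def G group_BijGroup)
qed

lemma group_action_cl:
  "group_action G E \<phi> \<Longrightarrow> g \<in> carrier G \<Longrightarrow> x \<in> E \<Longrightarrow> \<phi> g x \<in> E"
  by (metis group_action.element_image)

lemma flowI:
  assumes "topspace X \<noteq> {}" "compact_space X" "Hausdorff_space X"
    and act: "group_action G (topspace X) \<alpha>"
    and cont: "\<And>\<gamma>. \<gamma> \<in> carrier G \<Longrightarrow> continuous_map X X (\<alpha> \<gamma>)"
  shows "flow G X \<alpha>"
proof -
  let ?D = "discrete_topology (carrier G)"
  have "continuous_map (prod_topology ?D X) X (\<lambda>(\<gamma>, x). \<alpha> \<gamma> x)"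
    unfolding continuous_map_def
  proof (intro conjI allI impI)
    show "(\<lambda>(\<gamma>, x). \<alpha> \<gamma> x) \<in> topspace (prod_topology ?D X) \<rightarrow> topspace X"
      using group_action_cl[OF act] by auto
  next
    fix U assume U: "openin X U"
    have "{p \<in> topspace (prod_topology ?D X). (\<lambda>(\<gamma>, x). \<alpha> \<gamma> x) p \<in> U} =
          (\<Union>\<gamma>\<in>carrier G. {\<gamma>} \<times> {x \<in> topspace X. \<alpha> \<gamma> x \<in> U})"
      by auto
    moreover have "openin (prod_topology ?D X) ({\<gamma>} \<times> {x \<in> topspace X. \<alpha> \<gamma> x \<in> U})"
      if "\<gamma> \<in> carrier G" for \<gamma>
      using that openin_continuous_map_preimage[OF cont[OF that] U]
      by (simp add: openin_prod_Times_iff)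
    ultimately show "openin (prod_topology ?D X)
        {p \<in> topspace (prod_topology ?D X). (\<lambda>(\<gamma>, x). \<alpha> \<gamma> x) p \<in> U}"
      by auto
  qed
  then show ?thesis
    using assms by (simp add: flow_def)
qed

lemma flow_continuous:
  assumes "flow G X \<alpha>" "\<gamma> \<in> carrier G"
  shows "continuous_map X X (\<alpha> \<gamma>)"
proof -
  have "continuous_map X (prod_topology (discrete_topology (carrier G)) X) (\<lambda>x. (\<gamma>, x))"
    using assms(2) by (simp add: continuous_map_pairwise o_def)
  then have "continuous_map X X ((\<lambda>(\<gamma>, x). \<alpha> \<gamma> x) \<circ> (\<lambda>x. (\<gamma>, x)))"
    using assms(1) unfolding flow_def by (blast intro: continuous_map_compose)
  then show ?thesis
    by (simp add: o_def)
qed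

lemma flow_shift:
  assumes "group G"
  shows "flow G (shift_space G) (shift_action G)"
proof -
  interpret group G by (fact assms)
  let ?E = "topspace (shift_space G)"
  have E: "?E = (\<Pi>\<^sub>E \<delta>\<in>carrier G. UNIV)"
    by (simp add: shift_space_def)
  have act: "group_action G ?E (shift_action G)"
  proof (rule group_actionI[OF assms])
    show "shift_action G \<one>\<^bsub>G\<^esub> x = x" if "x \<in> ?E" for x
      using that by (auto simp: shift_action_def E PiE_def extensional_def fun_eq_iff)
  qed (auto simp: shift_action_def E m_assoc intro!: ext)
  show ?thesis
  proof (rule flowI[OF _ _ _ act])
    show "?E \<noteq> {}"
      by (simp add: E PiE_eq_empty_iff)
    show "compact_space (shift_space G)"
      by (simp add: shift_space_def compact_space_product_topology compact_space_discrete_topology)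
    show "Hausdorff_space (shift_space G)"
      by (simp add: shift_space_def Hausdorff_space_product_topology)
  next
    fix \<gamma> assume \<gamma>: "\<gamma> \<in> carrier G"
    have "continuous_map (shift_space G) (shift_space G)
            (\<lambda>x. \<lambda>\<delta>\<in>carrier G. x (\<delta> \<otimes>\<^bsub>G\<^esub> \<gamma>))"
      unfolding shift_space_def continuous_map_componentwise
      using \<gamma> by (auto intro: continuous_map_product_projection)
    then show "continuous_map (shift_space G) (shift_space G) (shift_action G \<gamma>)"
      by (rule continuous_map_eq) (simp add: shift_action_def)
  qed
qed

lemma flow_subflow:
  assumes "subflow G X \<alpha> Y"
  shows "flow G (subtopology X Y) (restrict_action \<alpha> Y)"
proof -
  have fl: "flow G X \<alpha>" and ne: "Y \<noteq> {}" and cl: "closedin X Y"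
    and inv: "\<And>\<gamma> y. \<gamma> \<in> carrier G \<Longrightarrow> y \<in> Y \<Longrightarrow> \<alpha> \<gamma> y \<in> Y"
    using assms unfolding subflow_def by blast+
  have YX: "Y \<subseteq> topspace X"
    using cl by (rule closedin_subset)
  then have top: "topspace (subtopology X Y) = Y"
    by (rule topspace_subtopology_subset)
  have act: "group_action G (topspace X) \<alpha>"
    using fl by (simp add: flow_def)
  interpret act: group_action G "topspace X" \<alpha> by (fact act)
  have G: "group G"
    using act.group_hom by (simp add: group_hom_def)
  show ?thesis
  proof (rule flowI)
    show "topspace (subtopology X Y) \<noteq> {}"
      unfolding top by (fact ne)
    show "compact_space (subtopology X Y)"
      using fl cl by (simp add: flow_def closedin_compact_space compact_space_subtopology)
    show "Hausdorff_space (subtopology X Y)"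
      using fl by (simp add: flow_def Hausdorff_space_subtopology)
    have one: "\<alpha> \<one>\<^bsub>G\<^esub> y = y" if "y \<in> Y" for y
      using that YX act.id_eq_one by (metis restrict_apply' subsetD)
    have mult: "\<alpha> (g \<otimes>\<^bsub>G\<^esub> h) y = \<alpha> g (\<alpha> h y)"
      if "g \<in> carrier G" "h \<in> carrier G" "y \<in> Y" for g h y
      using that YX act.composition_rule by blast
    interpret group G by (fact G)
    show "group_action G (topspace (subtopology X Y)) (restrict_action \<alpha> Y)"
      unfolding top by (rule group_actionI[OF G]) (auto simp: inv one mult)
  next
    fix \<gamma> assume \<gamma>: "\<gamma> \<in> carrier G"
    have "continuous_map (subtopology X Y) (subtopology X Y) (\<alpha> \<gamma>)"
      using flow_continuous[OF fl \<gamma>] inv[OF \<gamma>]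
      by (auto simp: continuous_map_in_subtopology continuous_map_from_subtopology)
    then show "continuous_map (subtopology X Y) (subtopology X Y) (restrict (\<alpha> \<gamma>) Y)"
      by (rule continuous_map_eq) (simp only: top restrict_apply')
  qed
qed

end

theory Submission
  imports Defs
begin

text \<open>
  The subflow is the intersection of the closures of a decreasing sequence of nonempty shift-invariant sets of
  points, each of which settles one of countably many requirements.

  For a group element \<open>\<gamma>\<close> other than the identity, there must be a finite set
  \<open>T\<close> such that for each point \<open>z\<close> of the set and each \<open>h\<close> some
  \<open>t \<in> T\<close> satisfies \<open>z (t \<gamma> h) \<noteq> z (t h)\<close>. For an index
  \<open>n\<close> and a pattern on a finite window, either no point of the set contains the pattern at the
  identity, or some member \<open>F\<close> of the \<open>n\<close>-th family is such that in every point each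
  translate \<open>F h\<close> contains a place where the pattern occurs. Both properties pass to smaller sets
  and to closures; the first gives freeness, and the second gives minimality, since a nonempty open set contains
  all points of the limit that show a certain pattern at the identity. A pattern is treated only once: if it has
  disappeared by then, it does not come back.

  The difficulty is to retain enough freedom for the requirements that are still to come. Strong irreducibility
  of the sets of points would be the natural invariant, but points in which every \<open>F h\<close> is just
  barely served cannot be cut off along arbitrary finite sets. The invariant (locale \<open>pliable\<close>)
  therefore keeps track of pairs \<open>cut x R\<close> of a point and a finite set outside of which the point
  may be refilled freely. It demands that pieces at distance at least a fixed finite set \<open>K\<close> from
  each other can be glued, and that the result can be cut again along essentially all finite sets.

  Suppose that a template has to appear in every translate of a set \<open>F\<close> with \<open>N * N\<close>
  elements, \<open>N\<close> being large compared with \<open>K\<close> and the template. A pair is declared to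
  be a cut if for each \<open>h\<close> the template is already present at a place of \<open>F h\<close>, or at
  least \<open>N\<close> places of \<open>F h\<close> remain usable. Since \<open>N\<close> usable places
  suffice for a local lemma argument (\<open>block_constraints.ex_sat\<close>), pieces of this kind can be glued
  such that every \<open>F h\<close> is served, and those \<open>F h\<close> that do not touch the pieces are
  even served \<open>N\<close> times. When the result is cut along a finite set that contains every copy of the
  template near it, the \<open>N\<close> copies that serve such an \<open>F h\<close> are either present in the
  set or at usable places, and the invariant is restored (\<open>refinement.cut'_glue\<close>).
\<close>

section \<open>Colourings that hit every constraint\<close>

text \<open>
  A constraint \<open>i\<close> owns many disjoint blocks \<open>S i f\<close>, each with one prescribed
  pattern, and asks that at least one of its blocks carries its pattern. This is a form of the local lemma;
  instead of probabilities it uses a growth argument due to Rosenfeld: colouring one more vertex multiplies the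
  number of good partial colourings by at least \<open>\<beta>\<close>. The number
  \<open>\<rho> * \<beta> ^ s\<close> bounds the ways to miss the pattern on a block of \<open>s\<close>
  vertices, so that missing all \<open>N\<close> blocks costs a factor \<open>\<rho> ^ N\<close>, which beats
  the degree \<open>d\<close>.
\<close>
locale block_constraints =
  fixes A :: "'c set" and I :: "'i set" and F :: "'i \<Rightarrow> 'b set"
    and S :: "'i \<Rightarrow> 'b \<Rightarrow> 'v set" and q :: "'i \<Rightarrow> 'b \<Rightarrow> 'v \<Rightarrow> 'c"
    and k d N :: nat and \<beta> \<rho> :: real
  assumes finite_A: "finite A"
    and finite_F: "i \<in> I \<Longrightarrow> finite (F i)"
    and card_F: "i \<in> I \<Longrightarrow> N \<le> card (F i)"
    and N_pos: "0 < N"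
    and finite_S: "i \<in> I \<Longrightarrow> f \<in> F i \<Longrightarrow> finite (S i f)"
    and card_S: "i \<in> I \<Longrightarrow> f \<in> F i \<Longrightarrow> card (S i f) \<le> k"
    and disjoint_S: "i \<in> I \<Longrightarrow> f \<in> F i \<Longrightarrow> f' \<in> F i \<Longrightarrow> f \<noteq> f' \<Longrightarrow> S i f \<inter> S i f' = {}"
    and q_in: "i \<in> I \<Longrightarrow> f \<in> F i \<Longrightarrow> v \<in> S i f \<Longrightarrow> q i f v \<in> A"
    and degree: "finite {i\<in>I. v \<in> (\<Union>f\<in>F i. S i f)}" "card {i\<in>I. v \<in> (\<Union>f\<in>F i. S i f)} \<le> d"
    and \<beta>_pos: "0 < \<beta>" and \<rho>_le: "0 \<le> \<rho>" "\<rho> \<le> 1"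
    and block_bound: "s \<le> k \<Longrightarrow> real (card A ^ s) - 1 \<le> \<rho> * \<beta> ^ s"
    and gap: "\<beta> + real d * \<beta> * \<rho> ^ N \<le> real (card A)"
begin

definition supp :: "'i \<Rightarrow> 'v set" where
  "supp i = (\<Union>f\<in>F i. S i f)"

definition sat :: "('v \<Rightarrow> 'c) \<Rightarrow> 'i \<Rightarrow> bool" where
  "sat l i \<longleftrightarrow> (\<exists>f\<in>F i. \<forall>v\<in>S i f. l v = q i f v)"

definition good :: "'v set \<Rightarrow> ('v \<Rightarrow> 'c) set" where
  "good U = {l \<in> U \<rightarrow>\<^sub>E A. \<forall>i\<in>I. supp i \<subseteq> U \<longrightarrow> sat l i}"

lemma finite_supp: "i \<in> I \<Longrightarrow> finite (supp i)"
  by (auto simp: supp_def finite_F finite_S)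

lemma finite_good: "finite U \<Longrightarrow> finite (good U)"
  unfolding good_def by (rule finite_subset[of _ "U \<rightarrow>\<^sub>E A"]) (auto intro: finite_PiE finite_A)

lemma sat_cong:
  assumes "\<And>v. v \<in> supp i \<Longrightarrow> l v = l' v"
  shows "sat l i \<longleftrightarrow> sat l' i"
proof -
  have eq: "l v = l' v" if "f \<in> F i" "v \<in> S i f" for f v
    using that by (intro assms) (auto simp: supp_def)
  have "(\<forall>v\<in>S i f. l v = q i f v) \<longleftrightarrow> (\<forall>v\<in>S i f. l' v = q i f v)" if "f \<in> F i" for f
    using eq[OF that] by simp
  then show ?thesis by (simp add: sat_def)
qed

lemma good_restrict: "l \<in> good U \<Longrightarrow> W \<subseteq> U \<Longrightarrow> restrict l W \<in> good W"
proof -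
  assume l: "l \<in> good U" and W: "W \<subseteq> U"
  have "sat (restrict l W) i" if "i \<in> I" "supp i \<subseteq> W" for i
  proof -
    have "sat l i" using l W that by (auto simp: good_def)
    then show ?thesis using sat_cong[of i "restrict l W" l] that by (metis restrict_apply' subsetD)
  qed
  then show ?thesis using l W by (auto simp: good_def)
qed

text \<open>A violating colouring of the support misses the pattern of every block, and it is determined
  by its restrictions to the blocks.\<close>
lemma card_violating:
  assumes i: "i \<in> I"
  shows "real (card {l \<in> supp i \<rightarrow>\<^sub>E A. \<not> sat l i}) \<le> \<rho> ^ N * \<beta> ^ card (supp i)"
proof -
  let ?V = "{l \<in> supp i \<rightarrow>\<^sub>E A. \<not> sat l i}"
  let ?P = "\<lambda>f. (S i f \<rightarrow>\<^sub>E A) - {restrict (q i f) (S i f)}"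
  have fin: "finite (PiE (F i) ?P)"
    by (intro finite_PiE finite_F i finite_Diff finite_S finite_A) auto
  let ?r = "\<lambda>l. \<lambda>f\<in>F i. restrict l (S i f)"
  have inj: "inj_on ?r ?V"
  proof (rule inj_onI)
    fix l l' assume l: "l \<in> ?V" "l' \<in> ?V" and eq: "?r l = ?r l'"
    show "l = l'"
    proof (rule PiE_ext)
      show "l \<in> supp i \<rightarrow>\<^sub>E A" "l' \<in> supp i \<rightarrow>\<^sub>E A" using l by blast+
      fix v assume "v \<in> supp i"
      then obtain f where f: "f \<in> F i" "v \<in> S i f" unfolding supp_def by blast
      have "?r l f v = ?r l' f v" by (simp only: eq)
      then show "l v = l' v" using f by simp
    qed
  qed
  have sub: "?r ` ?V \<subseteq> PiE (F i) ?P"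
  proof (rule image_subsetI, rule restrict_PiE_iff[THEN iffD2], rule ballI)
    fix l f assume l: "l \<in> ?V" and f: "f \<in> F i"
    have "S i f \<subseteq> supp i" using f unfolding supp_def by blast
    then have "restrict l (S i f) \<in> S i f \<rightarrow>\<^sub>E A" using l by (auto simp: PiE_iff)
    moreover have "restrict l (S i f) \<noteq> restrict (q i f) (S i f)"
    proof
      assume "restrict l (S i f) = restrict (q i f) (S i f)"
      then have "\<forall>v\<in>S i f. l v = q i f v" by (metis restrict_apply')
      then have "sat l i" using f unfolding sat_def by blast
      then show False using l by blast
    qed
    ultimately show "restrict l (S i f) \<in> ?P f" by blast
  qed
  have "card ?V \<le> card (PiE (F i) ?P)"
    by (rule card_inj_on_le[OF inj sub fin])
  then have "real (card ?V) \<le> real (card (PiE (F i) ?P))"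
    by (rule of_nat_mono)
  also have "\<dots> = (\<Prod>f\<in>F i. real (card (?P f)))"
    unfolding card_PiE[OF finite_F[OF i]] by (rule of_nat_prod)
  also have "\<dots> \<le> (\<Prod>f\<in>F i. \<rho> * \<beta> ^ card (S i f))"
  proof (rule prod_mono, intro conjI)
    fix f assume f: "f \<in> F i"
    have "restrict (q i f) (S i f) \<in> S i f \<rightarrow>\<^sub>E A" using q_in[OF i f] by auto
    then have "card (?P f) = card A ^ card (S i f) - 1"
      using finite_S[OF i f] by (simp add: card_funcsetE)
    moreover have "0 < card (S i f \<rightarrow>\<^sub>E A)"
      using \<open>_ \<in> S i f \<rightarrow>\<^sub>E A\<close> finite_S[OF i f] finite_A
      unfolding card_gt_0_iff by (blast intro: finite_PiE)
    ultimately have "real (card (?P f)) = real (card A ^ card (S i f)) - 1"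
      using finite_S[OF i f] by (subst \<open>card (?P f) = _\<close>, subst of_nat_diff) (auto simp: card_funcsetE)
    then show "real (card (?P f)) \<le> \<rho> * \<beta> ^ card (S i f)"
      using block_bound[OF card_S[OF i f]] by simp
  qed auto
  also have "\<dots> = \<rho> ^ card (F i) * \<beta> ^ (\<Sum>f\<in>F i. card (S i f))"
    by (simp add: prod.distrib power_sum)
  also have "(\<Sum>f\<in>F i. card (S i f)) = card (supp i)"
    unfolding supp_def using i
    by (intro card_UN_disjoint[symmetric]) (auto simp: finite_F finite_S disjoint_S)
  also have "\<rho> ^ card (F i) * \<beta> ^ card (supp i) \<le> \<rho> ^ N * \<beta> ^ card (supp i)"
    using card_F[OF i] \<rho>_le \<beta>_pos by (intro mult_right_mono power_decreasing) auto
  finally show ?thesis .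
qed

text \<open>
  Of the \<open>card A\<close> extensions of a good colouring of \<open>U\<close> to \<open>v\<close>, the bad
  ones violate one of at most \<open>d\<close> constraints \<open>i\<close> through \<open>v\<close>. Such an
  extension is given by a good colouring of \<open>U - supp i\<close> and a violating colouring of
  \<open>supp i\<close>; by induction the former are fewer than the good colourings of \<open>U\<close> by at
  least a factor \<open>\<beta> ^ (card (supp i) - 1)\<close>.
\<close>
lemma card_good_insert:
  assumes "finite U" "v \<notin> U"
  shows "\<beta> * card (good U) \<le> card (good (insert v U))"
  using assms
proof (induction "card U" arbitrary: U v rule: less_induct)
  case less
  note U = \<open>finite U\<close> and v = \<open>v \<notin> U\<close>
  have chain: "\<beta> ^ card X * card (good Y) \<le> card (good (Y \<union> X))"
    if "finite X" "finite Y" "X \<inter> Y = {}" "card (Y \<union> X) \<le> card U" for X Y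
    using that
  proof (induction X)
    case (insert x X)
    have "card (Y \<union> X) < card (Y \<union> insert x X)"
      using insert by (intro psubset_card_mono) auto
    then have lt: "card (Y \<union> X) < card U" using insert.prems by simp
    have "\<beta> ^ card (insert x X) * card (good Y) = \<beta> * (\<beta> ^ card X * card (good Y))"
      using insert by simp
    also have "\<dots> \<le> \<beta> * card (good (Y \<union> X))"
      using insert lt \<beta>_pos by (intro mult_left_mono insert.IH) auto
    also have "\<dots> \<le> card (good (insert x (Y \<union> X)))"
      using insert lt by (intro less.hyps) auto
    finally show ?case by simp
  qed simp
  let ?E = "{l \<in> insert v U \<rightarrow>\<^sub>E A. restrict l U \<in> good U}"
  let ?I = "{i\<in>I. v \<in> supp i \<and> supp i \<subseteq> insert v U}"
  let ?B = "\<lambda>i. {l \<in> ?E. \<not> sat l i}"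
  have fin_E: "finite ?E"
    using U finite_A by (intro finite_subset[of ?E "insert v U \<rightarrow>\<^sub>E A"] finite_PiE) auto
  have fin_I: "finite ?I" and card_I: "card ?I \<le> d"
    using degree[of v] unfolding supp_def
    by (auto intro: finite_subset[rotated] order.trans[OF card_mono])
  have card_E: "card A * card (good U) \<le> card ?E"
  proof -
    have restr: "restrict (l(v := a)) U = l" if "l \<in> good U" for l a
      using that v by (auto simp: good_def fun_eq_iff PiE_def extensional_def)
    have sub: "(\<lambda>(a, l). l(v := a)) ` (A \<times> good U) \<subseteq> ?E"
    proof clarify
      fix a l assume "a \<in> A" "l \<in> good U"
      then show "l(v := a) \<in> insert v U \<rightarrow>\<^sub>E A \<and> restrict (l(v := a)) U \<in> good U"
        unfolding restr[OF \<open>l \<in> good U\<close>] by (auto simp: good_def PiE_def extensional_def)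
    qed
    have inj: "inj_on (\<lambda>(a, l). l(v := a)) (A \<times> good U)"
    proof (rule inj_onI, clarify)
      fix a l a' l' assume *: "l \<in> good U" "l' \<in> good U" "l(v := a) = l'(v := a')"
      show "a = a' \<and> l = l'" using * restr[of l a] restr[of l' a'] by (metis fun_upd_same)
    qed
    have "card (A \<times> good U) \<le> card ?E" by (rule card_inj_on_le[OF inj sub fin_E])
    then show ?thesis by (simp add: card_cartesian_product)
  qed
  have bad: "real (card (?B i)) \<le> \<beta> * \<rho> ^ N * card (good U)" if i: "i \<in> ?I" for i
  proof -
    let ?V = "{l \<in> supp i \<rightarrow>\<^sub>E A. \<not> sat l i}"
    let ?Y = "U - supp i"
    have fin: "finite (supp i)" using i finite_supp by auto
    let ?r = "\<lambda>l. (restrict l ?Y, restrict l (supp i))"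
    have inj: "inj_on ?r (?B i)"
    proof (rule inj_onI)
      fix l l' assume l: "l \<in> ?B i" "l' \<in> ?B i" "?r l = ?r l'"
      show "l = l'"
      proof (rule PiE_ext[of l "insert v U" "\<lambda>_. A"])
        fix w assume "w \<in> insert v U"
        then have "w \<in> ?Y \<or> w \<in> supp i" using i by auto
        then show "l w = l' w" using l(3) by (metis prod.inject restrict_apply')
      qed (use l in auto)
    qed
    have sub: "?r ` ?B i \<subseteq> good ?Y \<times> ?V"
    proof clarsimp
      fix l assume l: "l \<in> insert v U \<rightarrow>\<^sub>E A" "restrict l U \<in> good U" "\<not> sat l i"
      have "restrict (restrict l U) ?Y \<in> good ?Y" by (rule good_restrict[OF l(2)]) auto
      moreover have "\<not> sat (restrict l (supp i)) i"
        using l(3) sat_cong[of i "restrict l (supp i)" l] by simp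
      ultimately show "restrict l ?Y \<in> good ?Y \<and> l \<in> supp i \<rightarrow> A \<and> \<not> sat (restrict l (supp i)) i"
        using l(1) i by (auto simp: restrict_restrict Int_absorb1 PiE_iff)
    qed
    have "finite ?V"
      using fin finite_A by (intro finite_subset[of ?V "supp i \<rightarrow>\<^sub>E A"] finite_PiE) auto
    then have "finite (good ?Y \<times> ?V)" using U finite_good by auto
    then have "card (?B i) \<le> card (good ?Y \<times> ?V)" by (rule card_inj_on_le[OF inj sub])
    then have "card (?B i) \<le> card (good ?Y) * card ?V"
      unfolding card_cartesian_product .
    then have "real (card (?B i)) \<le> real (card (good ?Y)) * real (card ?V)"
      unfolding of_nat_mult[symmetric] of_nat_le_iff .
    also have "\<dots> \<le> real (card (good ?Y)) * (\<rho> ^ N * \<beta> ^ card (supp i))"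
      using card_violating i by (intro mult_left_mono) auto
    also have "card (supp i) = Suc (card (supp i - {v}))"
      using i by (intro card.remove[OF fin]) blast
    also have "real (card (good ?Y)) * (\<rho> ^ N * \<beta> ^ Suc (card (supp i - {v})))
        = \<beta> * \<rho> ^ N * (\<beta> ^ card (supp i - {v}) * card (good ?Y))" by simp
    also have "\<dots> \<le> \<beta> * \<rho> ^ N * card (good U)"
    proof -
      have "?Y \<union> (supp i - {v}) = U" using v i by auto
      moreover have "\<beta> ^ card (supp i - {v}) * card (good ?Y) \<le> card (good (?Y \<union> (supp i - {v})))"
        using U v i fin by (intro chain) (auto intro!: card_mono)
      ultimately show ?thesis using \<beta>_pos \<rho>_le by (intro mult_left_mono) auto
    qed
    finally show ?thesis .
  qed
  have "?E \<subseteq> good (insert v U) \<union> (\<Union>i\<in>?I. ?B i)"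
  proof
    fix l assume l: "l \<in> ?E"
    show "l \<in> good (insert v U) \<union> (\<Union>i\<in>?I. ?B i)"
    proof (rule ccontr)
      assume no: "l \<notin> good (insert v U) \<union> (\<Union>i\<in>?I. ?B i)"
      then obtain i where i: "i \<in> I" "supp i \<subseteq> insert v U" "\<not> sat l i"
        using l by (auto simp: good_def)
      then have "v \<notin> supp i" using l no by auto
      then have "supp i \<subseteq> U" using i by auto
      then have "sat (restrict l U) i" using l i by (auto simp: good_def)
      then show False using i sat_cong[of i "restrict l U" l] \<open>supp i \<subseteq> U\<close>
        by (metis restrict_apply' subsetD)
    qed
  qed
  moreover have "finite (good (insert v U) \<union> (\<Union>i\<in>?I. ?B i))"
    using finite_good[of "insert v U"] U
    by (intro finite_UnI finite_UN_I fin_I) (auto intro: finite_subset[OF _ fin_E])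
  ultimately have "card A * card (good U) \<le> card (good (insert v U) \<union> (\<Union>i\<in>?I. ?B i))"
    by (intro order.trans[OF card_E] card_mono)
  also have "\<dots> \<le> card (good (insert v U)) + card (\<Union>i\<in>?I. ?B i)" by (rule card_Un_le)
  also have "card (\<Union>i\<in>?I. ?B i) \<le> (\<Sum>i\<in>?I. card (?B i))" by (rule card_UN_le[OF fin_I])
  finally have "real (card A * card (good U)) \<le>
      real (card (good (insert v U)) + (\<Sum>i\<in>?I. card (?B i)))"
    by (intro of_nat_mono) simp
  also have "\<dots> = real (card (good (insert v U))) + (\<Sum>i\<in>?I. real (card (?B i)))"
    unfolding of_nat_add of_nat_sum ..
  also have "(\<Sum>i\<in>?I. real (card (?B i))) \<le> card ?I * (\<beta> * \<rho> ^ N * card (good U))"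
    using bad by (intro sum_bounded_above)
  also have "\<dots> \<le> d * (\<beta> * \<rho> ^ N * card (good U))"
    using card_I \<beta>_pos \<rho>_le by (intro mult_right_mono) auto
  finally have "real (card A * card (good U)) - d * (\<beta> * \<rho> ^ N * card (good U)) \<le> card (good (insert v U))"
    by simp
  moreover have "\<beta> * card (good U) \<le> (card A - d * \<beta> * \<rho> ^ N) * card (good U)"
    using gap by (intro mult_right_mono) auto
  ultimately show ?case by (simp add: algebra_simps)
qed

lemma good_nonempty: "finite U \<Longrightarrow> good U \<noteq> {}"
proof (induction U rule: finite_induct)
  case empty
  have "sat (\<lambda>_. undefined) i" if "i \<in> I" "supp i = {}" for i
  proof -
    have "card (F i) \<noteq> 0" using card_F[OF that(1)] N_pos by simp
    then obtain f where "f \<in> F i" by fastforce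
    then show ?thesis using that unfolding sat_def supp_def by auto
  qed
  then show ?case by (auto simp: good_def)
next
  case (insert v U)
  have "0 < \<beta> * card (good U)" using insert \<beta>_pos finite_good by (simp add: card_gt_0_iff)
  then have "0 < card (good (insert v U))" using card_good_insert[of U v] insert by linarith
  then show ?case by auto
qed

text \<open>Finitely many constraints are satisfied by a good colouring of the union of their supports;
  compactness of the product of copies of the finite set \<open>A\<close> does the rest.\<close>
theorem ex_sat: "\<exists>l. (\<forall>v. l v \<in> A) \<and> (\<forall>i\<in>I. sat l i)"
proof -
  have "card A > 0"
  proof -
    have "0 < real (card A)" using gap \<beta>_pos \<rho>_le
      by (smt (verit) mult_nonneg_nonneg of_nat_0_le_iff zero_le_power)
    then show ?thesis by simp
  qed
  then obtain a where a: "a \<in> A" by (metis card.empty ex_in_conv less_irrefl)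
  let ?X = "product_topology (\<lambda>_. discrete_topology A) (UNIV :: 'v set)"
  let ?Z = "\<lambda>i. {l \<in> topspace ?X. sat l i}"
  have "compact_space ?X"
    using finite_A by (auto simp: compact_space_product_topology compact_space_discrete_topology)
  moreover have "closedin ?X (?Z i)" if i: "i \<in> I" for i
  proof -
    have cl: "closedin ?X {l \<in> topspace ?X. l v \<in> {c}}" if "c \<in> A" for v c
      using that by (intro closedin_continuous_map_preimage[where Y = "discrete_topology A"])
        (auto intro: continuous_map_product_projection)
    have "?Z i = (\<Union>f\<in>F i. topspace ?X \<inter> (\<Inter>v\<in>S i f. {l \<in> topspace ?X. l v \<in> {q i f v}}))"
      by (auto simp: sat_def)
    moreover have "closedin ?X (topspace ?X \<inter> (\<Inter>v\<in>S i f. {l \<in> topspace ?X. l v \<in> {q i f v}}))"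
      if f: "f \<in> F i" for f
    proof (cases "S i f = {}")
      case False
      then show ?thesis
        using q_in[OF i f] by (intro closedin_Int closedin_topspace closedin_INT cl) auto
    next
      case True
      then show ?thesis by (metis INT_empty closedin_topspace inf_top_right)
    qed
    ultimately show ?thesis using finite_F[OF i] by (simp only:) (intro closedin_Union, auto)
  qed
  moreover have "\<Inter>\<U> \<noteq> {}" if fin: "finite \<U>" and sub: "\<U> \<subseteq> ?Z ` I" for \<U>
  proof -
    obtain J where J: "finite J" "J \<subseteq> I" "\<U> = ?Z ` J"
      using finite_subset_image[OF fin sub] by blast
    let ?U = "\<Union>i\<in>J. supp i"
    obtain l where l: "l \<in> good ?U" using good_nonempty[of ?U] J finite_supp by blast
    define l' where "l' = (\<lambda>v. if v \<in> ?U then l v else a)"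
    have "sat l' i" if "i \<in> J" for i
    proof -
      have "sat l i" using l J that by (auto simp: good_def)
      then show ?thesis using sat_cong[of i l l'] that unfolding l'_def by (metis (mono_tags) UN_I)
    qed
    moreover have "l' \<in> topspace ?X" using l a by (auto simp: good_def l'_def PiE_def Pi_def)
    ultimately have "l' \<in> \<Inter>\<U>" using J by auto
    then show ?thesis by blast
  qed
  ultimately have "\<Inter>(insert (topspace ?X) (?Z ` I)) \<noteq> {}"
  proof -
    assume c: "compact_space ?X" and cl: "\<And>i. i \<in> I \<Longrightarrow> closedin ?X (?Z i)"
      and fip: "\<And>\<U>. finite \<U> \<Longrightarrow> \<U> \<subseteq> ?Z ` I \<Longrightarrow> \<Inter>\<U> \<noteq> {}"
    have ne: "(\<lambda>_. a) \<in> topspace ?X" using a by auto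
    have "\<Inter>\<U> \<noteq> {}" if "finite \<U>" "\<U> \<subseteq> insert (topspace ?X) (?Z ` I)" for \<U>
    proof (cases "\<U> \<subseteq> {topspace ?X}")
      case True then show ?thesis using ne by (metis Inter_iff empty_iff subset_singletonD singletonD)
    next
      case False
      then obtain Z where Z: "Z \<in> \<U> - {topspace ?X}" by auto
      have "\<Inter>(\<U> - {topspace ?X}) \<noteq> {}" using that by (intro fip) auto
      then obtain l where l: "l \<in> \<Inter>(\<U> - {topspace ?X})" by auto
      have "Z \<in> ?Z ` I" using Z that by auto
      then have "l \<in> topspace ?X" using l Z by blast
      then have "l \<in> \<Inter>\<U>" using l by blast
      then show ?thesis by blast
    qed
    then show ?thesis
      using c[unfolded compact_space_fip, rule_format, of "insert (topspace ?X) (?Z ` I)"] cl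
      by (metis (no_types, lifting) closedin_topspace image_iff insert_iff)
  qed
  then show ?thesis by (auto simp: PiE_def)
qed

end

text \<open>
  With \<open>\<beta> ^ k = a ^ k - 1 / 2\<close> the growth rate stays strictly below \<open>a\<close> while
  the ratio \<open>\<rho> = (a ^ k - 1) / \<beta> ^ k\<close> stays strictly below \<open>1\<close>, so
  \<open>\<rho> ^ N\<close> outweighs any polynomial in \<open>N\<close>. The degree that has to be beaten later
  is cubic in \<open>N\<close>.
\<close>
lemma ex_block_parameters:
  fixes a k C M :: nat
  assumes "1 \<le> a" "1 \<le> k"
  obtains \<beta> \<rho> :: real and N :: nat where
    "0 < \<beta>" "0 \<le> \<rho>" "\<rho> \<le> 1" "M \<le> N" "0 < N"
    "\<And>s. s \<le> k \<Longrightarrow> real (a ^ s) - 1 \<le> \<rho> * \<beta> ^ s"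
    "\<beta> + real (C * N ^ 3) * \<beta> * \<rho> ^ N \<le> real a"
proof -
  define \<beta> where "\<beta> = root k (real a ^ k - 1 / 2)"
  define \<rho> where "\<rho> = (real a ^ k - 1) / \<beta> ^ k"
  have ak: "1 \<le> real a ^ k" using assms by (simp add: one_le_power)
  have \<beta>k: "\<beta> ^ k = real a ^ k - 1 / 2" unfolding \<beta>_def using assms ak by (intro real_root_pow_pos2) linarith+
  have \<beta>_pos: "0 < \<beta>"
    unfolding \<beta>_def using assms ak by (intro real_root_gt_zero) linarith+
  have "\<beta> < root k (real a ^ k)" unfolding \<beta>_def using assms by (intro real_root_less_mono) auto
  also have "\<dots> = real a" using assms by (intro real_root_power_cancel) auto
  finally have \<beta>_less: "\<beta> < real a" .
  have \<rho>: "0 \<le> \<rho>" "\<rho> < 1" unfolding \<rho>_def \<beta>k using ak by (auto simp: field_simps)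
  have bound: "real (a ^ s) - 1 \<le> \<rho> * \<beta> ^ s" if "s \<le> k" for s
  proof -
    have "(real a ^ s - 1) * \<beta> ^ (k - s) \<le> (real a ^ s - 1) * real a ^ (k - s)"
      using \<beta>_pos \<beta>_less assms by (intro mult_left_mono power_mono) (auto simp: one_le_power)
    also have "\<dots> = real a ^ k - real a ^ (k - s)"
      using that by (simp add: algebra_simps flip: power_add)
    also have "\<dots> \<le> real a ^ k - 1" using assms by (simp add: one_le_power)
    also have "\<dots> = \<rho> * \<beta> ^ s * \<beta> ^ (k - s)"
      using that \<beta>_pos by (simp add: \<rho>_def mult.assoc flip: power_add)
    finally show ?thesis using \<beta>_pos by (simp add: mult_le_cancel_right)
  qed
  have "(\<lambda>n. real n ^ 3 * \<rho> ^ n) \<longlonglongrightarrow> 0"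
  proof (cases "\<rho> = 0")
    case True
    then have "eventually (\<lambda>n. real n ^ 3 * \<rho> ^ n = 0) sequentially"
      by (intro eventually_sequentiallyI[of 1]) auto
    then show ?thesis by (rule tendsto_eventually)
  next
    case False
    define r where "r = root 3 \<rho>"
    have r: "0 < r" "r < 1" "\<rho> = r ^ 3" using False \<rho> by (auto simp: r_def)
    have "(\<lambda>n. (real n * r ^ n) ^ 3) \<longlonglongrightarrow> 0 ^ 3"
      using powser_times_n_limit_0[of r] r by (intro tendsto_power) auto
    then show ?thesis by (simp add: r(3) power_mult_distrib flip: power_mult) (simp add: mult.commute)
  qed
  then have "(\<lambda>n. real C * \<beta> * (real n ^ 3 * \<rho> ^ n)) \<longlonglongrightarrow> real C * \<beta> * 0"
    by (rule tendsto_mult_left)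
  then have "eventually (\<lambda>n. real C * \<beta> * (real n ^ 3 * \<rho> ^ n) < real a - \<beta>) sequentially"
    using \<beta>_less by (intro order_tendstoD(2)) auto
  then have "eventually (\<lambda>n. real C * \<beta> * (real n ^ 3 * \<rho> ^ n) < real a - \<beta> \<and> M \<le> n \<and> 0 < n) sequentially"
    using eventually_ge_at_top[of M] eventually_gt_at_top[of 0] by eventually_elim auto
  then obtain N where "real C * \<beta> * (real N ^ 3 * \<rho> ^ N) < real a - \<beta>" "M \<le> N" "0 < N"
    using eventually_happens'[OF sequentially_bot] by blast
  then show ?thesis using \<beta>_pos \<rho> bound by (intro that[of \<beta> \<rho> N]) (auto simp: algebra_simps)
qed

section \<open>Pliable families of points\<close>

context monoid
begin

definition shift :: "'a \<Rightarrow> ('a \<Rightarrow> bool) \<Rightarrow> ('a \<Rightarrow> bool)" where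
  "shift g x = (\<lambda>d. x (d \<otimes> g))"

text \<open>The double neighbourhood on one side allows a set to be enlarged by whole neighbourhoods of pieces without
  meeting any further piece.\<close>
definition separated :: "'a set \<Rightarrow> (('a \<Rightarrow> bool) \<times> 'a set) set \<Rightarrow> bool" where
  "separated K \<I> \<longleftrightarrow> (\<forall>p\<in>\<I>. \<forall>p'\<in>\<I>. p \<noteq> p' \<longrightarrow> (K <#> (K <#> snd p)) \<inter> (K <#> snd p') = {})"

text \<open>A window is clean if its boundary does not run close to any piece.\<close>
definition clean :: "'a set \<Rightarrow> (('a \<Rightarrow> bool) \<times> 'a set) set \<Rightarrow> 'a set \<Rightarrow> bool" where
  "clean K \<I> W \<longleftrightarrow> (\<forall>p\<in>\<I>. K <#> snd p \<subseteq> W \<or> (K <#> snd p) \<inter> (K <#> W) = {})"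

end

context group
begin

lemma finite_set_mult: "finite A \<Longrightarrow> finite B \<Longrightarrow> finite (A <#> B)"
  by (auto simp: set_mult_def)

lemma finite_r_coset: "finite A \<Longrightarrow> finite (A #> g)"
  by (auto simp: r_coset_def)

lemma subset_set_mult: "\<one> \<in> K \<Longrightarrow> W \<subseteq> carrier G \<Longrightarrow> W \<subseteq> K <#> W"
  by (force simp: set_mult_def)

lemma set_mult_UN: "A <#> (\<Union>i\<in>I. X i) = (\<Union>i\<in>I. A <#> X i)"
  by (auto simp: set_mult_def)

lemma set_mult_Un: "A <#> (X \<union> Y) = (A <#> X) \<union> (A <#> Y)"
  by (auto simp: set_mult_def)

lemma in_set_mult: "a \<in> A \<Longrightarrow> b \<in> X \<Longrightarrow> a \<otimes> b \<in> A <#> X"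
  unfolding set_mult_def by blast

lemma in_r_coset: "a \<in> A \<Longrightarrow> a \<otimes> c \<in> A #> c"
  unfolding r_coset_def by blast

lemma coset_subset_set_mult: "A \<subseteq> A' \<Longrightarrow> c \<in> X \<Longrightarrow> A #> c \<subseteq> A' <#> X"
  unfolding r_coset_def set_mult_def by blast

lemma separatedD:
  "separated K \<I> \<Longrightarrow> p \<in> \<I> \<Longrightarrow> p' \<in> \<I> \<Longrightarrow> p \<noteq> p' \<Longrightarrow>
    (K <#> (K <#> snd p)) \<inter> (K <#> snd p') = {}"
  unfolding separated_def by blast

end

text \<open>
  The formula \<open>cut x R\<close> says that the values of \<open>x\<close> on the finite set \<open>R\<close>
  may be kept while everything outside is erased and filled in again. By \<open>glue\<close>, separated pieces
  of this kind extend to a common point, and the new point can itself be cut along every clean window, up to an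
  enlargement by \<open>K\<close>. That the enlargement depends on \<open>K\<close> only, and not on the pieces
  or the window, is what allows the construction to be iterated. By \<open>cut_small\<close>, two values can be
  prescribed arbitrarily at any two places, however close; this is the reserve from which freeness is obtained
  in the end.
\<close>
locale pliable = group G for G :: "('g, 'm) monoid_scheme" (structure) +
  fixes cut :: "('g \<Rightarrow> bool) \<Rightarrow> 'g set \<Rightarrow> bool" and K :: "'g set"
  assumes K_fin: "finite K" and K_carrier: "K \<subseteq> carrier G" and one_K: "\<one> \<in> K"
    and cut_fin: "cut x R \<Longrightarrow> finite R" and cut_carrier: "cut x R \<Longrightarrow> R \<subseteq> carrier G"
    and cut_shift: "cut x R \<Longrightarrow> g \<in> carrier G \<Longrightarrow> cut (shift g x) (R #> inv g)"
    and cut_small: "finite R \<Longrightarrow> R \<subseteq> carrier G \<Longrightarrow> card R \<le> 2 \<Longrightarrow> cut x R"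
    and glue: "\<forall>p\<in>\<I>. cut (fst p) (snd p) \<Longrightarrow> separated K \<I> \<Longrightarrow>
      \<exists>x. (\<forall>p\<in>\<I>. \<forall>r\<in>snd p. x r = fst p r) \<and>
          (\<forall>W. finite W \<longrightarrow> W \<subseteq> carrier G \<longrightarrow> clean K \<I> W \<longrightarrow>
            (\<exists>R. W \<subseteq> R \<and> R \<subseteq> K <#> W \<and> cut x R))"

context pliable
begin

definition points :: "('g \<Rightarrow> bool) set" where
  "points = {x. \<forall>W. finite W \<longrightarrow> W \<subseteq> carrier G \<longrightarrow> (\<exists>R. W \<subseteq> R \<and> cut x R)}"

lemma K_mult_carrier: "W \<subseteq> carrier G \<Longrightarrow> K <#> W \<subseteq> carrier G"
  by (rule set_mult_closed[OF K_carrier])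

lemma subset_K_mult: "W \<subseteq> carrier G \<Longrightarrow> W \<subseteq> K <#> W"
  by (rule subset_set_mult[OF one_K])

text \<open>Every finite set becomes clean when the neighbourhoods of the pieces close to it are added, and
  there are only finitely many of these because the neighbourhoods are disjoint.\<close>
lemma glue_point:
  assumes cut: "\<forall>p\<in>\<I>. cut (fst p) (snd p)" and sep: "separated K \<I>"
  shows "\<exists>x\<in>points. \<forall>p\<in>\<I>. \<forall>r\<in>snd p. x r = fst p r"
proof -
  obtain x where x: "\<forall>p\<in>\<I>. \<forall>r\<in>snd p. x r = fst p r"
    and ext: "\<forall>W. finite W \<longrightarrow> W \<subseteq> carrier G \<longrightarrow> clean K \<I> W \<longrightarrow>
      (\<exists>R. W \<subseteq> R \<and> R \<subseteq> K <#> W \<and> cut x R)"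
    using glue[OF cut sep] by (elim exE conjE)
  have "\<exists>R. W \<subseteq> R \<and> cut x R" if W: "finite W" "W \<subseteq> carrier G" for W
  proof -
    let ?M = "{p\<in>\<I>. (K <#> snd p) \<inter> (K <#> W) \<noteq> {}}"
    let ?V = "W \<union> (\<Union>p\<in>?M. K <#> snd p)"
    have car: "snd p \<subseteq> carrier G" "finite (snd p)" if "p \<in> \<I>" for p
      using cut_carrier cut_fin cut that by blast+
    have "finite ?M"
    proof (rule inj_on_finite)
      let ?e = "\<lambda>p. SOME v. v \<in> (K <#> snd p) \<inter> (K <#> W)"
      have e: "?e p \<in> (K <#> snd p) \<inter> (K <#> W)" if "p \<in> ?M" for p
        using that by (intro someI_ex[of "\<lambda>v. v \<in> (K <#> snd p) \<inter> (K <#> W)"]) auto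
      show "?e ` ?M \<subseteq> K <#> W" using e by blast
      show "finite (K <#> W)" by (rule finite_set_mult[OF K_fin W(1)])
      show "inj_on ?e ?M"
      proof (rule inj_onI, rule ccontr)
        fix p p' assume p: "p \<in> ?M" "p' \<in> ?M" "?e p = ?e p'" "p \<noteq> p'"
        have "?e p \<in> K <#> (K <#> snd p)"
          using e[OF p(1)] subset_K_mult[OF K_mult_carrier[of "snd p"]] car p(1) by blast
        moreover have "?e p \<in> K <#> snd p'" using e[OF p(2)] p(3) by simp
        ultimately show False using separatedD[OF sep, of p p'] p(1,2,4) by blast
      qed
    qed
    then have fin: "finite ?V" using W car K_fin by (auto intro: finite_set_mult)
    have V: "?V \<subseteq> carrier G" using W(2) car K_mult_carrier by blast
    have "clean K \<I> ?V"
      unfolding clean_def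
    proof (intro ballI disjCI)
      fix p assume p: "p \<in> \<I>" and meets: "(K <#> snd p) \<inter> (K <#> ?V) \<noteq> {}"
      have "p \<in> ?M"
      proof (cases "(K <#> snd p) \<inter> (K <#> W) = {}")
        case True
        then obtain p' where p': "p' \<in> ?M" "(K <#> snd p) \<inter> (K <#> (K <#> snd p')) \<noteq> {}"
          using meets unfolding set_mult_Un set_mult_UN by blast
        then have "p = p'" using separatedD[OF sep, of p' p] p by (metis (lifting) Int_commute mem_Collect_eq)
        then show ?thesis using p' by simp
      qed (use p in blast)
      then show "K <#> snd p \<subseteq> ?V" by blast
    qed
    then show ?thesis using ext[rule_format, OF fin V] by blast
  qed
  then have "x \<in> points" unfolding points_def by simp
  then show ?thesis using x by blast
qed

end

section \<open>Forcing a family of templates into every translate\<close>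

text \<open>
  The aim is to make all points contain, for every \<open>h\<close> and some \<open>f \<in> F\<close>, a copy of
  the template \<open>(y j, P j)\<close> at the place \<open>\<sigma> j f \<otimes> h\<close>, for all
  \<open>j \<in> J\<close> at once. The sets \<open>U\<close> and \<open>B\<close> are safety zones: a copy at
  \<open>c\<close> is separated from every piece that misses \<open>U #> c\<close> (\<open>U_apart\<close>), and
  two copies whose places are not \<open>B\<close>-close do not reach into each other's \<open>U\<close>-zone
  (\<open>B_apart\<close>). The set \<open>F\<close> has \<open>N * N\<close> elements, so that it splits into
  \<open>N\<close> parts of size \<open>N\<close> and each part can be hit separately.
\<close>
locale refinement = pliable G cut K for G :: "('g, 'm) monoid_scheme" (structure) and cut K +
  fixes J :: "nat set" and y :: "nat \<Rightarrow> 'g \<Rightarrow> bool" and P :: "nat \<Rightarrow> 'g set"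
    and U B F :: "'g set" and \<sigma> :: "nat \<Rightarrow> 'g \<Rightarrow> 'g" and N :: nat and \<beta> \<rho> :: real
  assumes J_fin: "finite J"
    and template: "j \<in> J \<Longrightarrow> cut (y j) (P j)"
    and U_fin: "finite U" and U_carrier: "U \<subseteq> carrier G" and one_U: "\<one> \<in> U"
    and B_fin: "finite B" and B_carrier: "B \<subseteq> carrier G" and one_B: "\<one> \<in> B"
    and KP_U: "j \<in> J \<Longrightarrow> K <#> P j \<subseteq> U"
    and U_apart: "j \<in> J \<Longrightarrow> c \<in> carrier G \<Longrightarrow> R \<subseteq> carrier G \<Longrightarrow> (U #> c) \<inter> R = {} \<Longrightarrow>
      (K <#> (K <#> (P j #> c))) \<inter> (K <#> R) = {} \<and> (K <#> (K <#> R)) \<inter> (K <#> (P j #> c)) = {}"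
    and B_apart: "j \<in> J \<Longrightarrow> c \<in> carrier G \<Longrightarrow> c' \<in> carrier G \<Longrightarrow> c' \<notin> B #> c \<Longrightarrow>
      (U #> c) \<inter> (K <#> (K <#> (P j #> c'))) = {}"
    and F_fin: "finite F" and card_F: "card F = N * N"
    and \<sigma>_carrier: "j \<in> J \<Longrightarrow> f \<in> F \<Longrightarrow> \<sigma> j f \<in> carrier G"
    and spread: "f \<in> F \<Longrightarrow> f' \<in> F \<Longrightarrow> f \<noteq> f' \<Longrightarrow> i \<in> J \<Longrightarrow> j \<in> J \<Longrightarrow>
      (B #> \<sigma> i f) \<inter> (B #> \<sigma> j f') = {}"
    and consistent: "f \<in> F \<Longrightarrow> i \<in> J \<Longrightarrow> j \<in> J \<Longrightarrow> i \<noteq> j \<Longrightarrow> \<sigma> j f \<notin> B #> \<sigma> i f"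
    and N_pos: "0 < N" and N_large: "N + 2 * card J * card U \<le> N * N"
    and \<beta>_pos: "0 < \<beta>" and \<rho>_le: "0 \<le> \<rho>" "\<rho> \<le> 1"
    and block_bound: "s \<le> card J * card B \<Longrightarrow> real (Suc (card J) ^ s) - 1 \<le> \<rho> * \<beta> ^ s"
    and gap: "\<beta> + real (card J * card B * N ^ 3) * \<beta> * \<rho> ^ N \<le> real (Suc (card J))"
begin

lemma \<sigma>_mult_carrier: "j \<in> J \<Longrightarrow> f \<in> F \<Longrightarrow> h \<in> carrier G \<Longrightarrow> \<sigma> j f \<otimes> h \<in> carrier G"
  using \<sigma>_carrier by simp

lemma self_r_coset: "g \<in> carrier G \<Longrightarrow> g \<in> B #> g"
  using one_B by (force simp: r_coset_def)

lemma \<sigma>_inj: "inj_on (\<sigma> j) F" if "j \<in> J"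
proof (rule inj_onI, rule ccontr)
  fix f f' assume "f \<in> F" "f' \<in> F" "\<sigma> j f = \<sigma> j f'" "f \<noteq> f'"
  then show False using spread[of f f' j j] self_r_coset[of "\<sigma> j f"] \<sigma>_carrier that by auto
qed

lemma \<sigma>_distinct: "f \<in> F \<Longrightarrow> i \<in> J \<Longrightarrow> j \<in> J \<Longrightarrow> \<sigma> i f = \<sigma> j f \<Longrightarrow> i = j"
  using consistent[of f i j] self_r_coset[of "\<sigma> i f"] \<sigma>_carrier by metis

text \<open>
  A label \<open>Some j\<close> at \<open>c\<close> proposes a copy of template \<open>j\<close> at
  \<open>c\<close>. For each \<open>h\<close>, every set in \<open>\<S> h\<close> is a constraint with one block
  for each of its elements \<open>f\<close>: the union over \<open>j\<close> of the \<open>B\<close>-zones of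
  the places \<open>\<sigma> j f \<otimes> h\<close>, where these places are to be labelled and the rest of the
  zones left empty.
\<close>
lemma ex_labelling:
  assumes S: "\<And>h. h \<in> carrier G \<Longrightarrow> finite (\<S> h) \<and> card (\<S> h) \<le> N"
    and \<Phi>: "\<And>h \<Phi>. h \<in> carrier G \<Longrightarrow> \<Phi> \<in> \<S> h \<Longrightarrow> \<Phi> \<subseteq> F \<and> N \<le> card \<Phi>"
  shows "\<exists>l. (\<forall>v. l v \<in> insert None (Some ` J)) \<and>
    (\<forall>h\<in>carrier G. \<forall>\<Phi>\<in>\<S> h. \<exists>f\<in>\<Phi>. \<forall>j\<in>J. l (\<sigma> j f \<otimes> h) = Some j \<and>
       (\<forall>v\<in>B #> (\<sigma> j f \<otimes> h). v \<noteq> \<sigma> j f \<otimes> h \<longrightarrow> l v = None))"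
proof -
  let ?A = "insert None (Some ` J)"
  let ?I = "{(h, \<Phi>). h \<in> carrier G \<and> \<Phi> \<in> \<S> h}"
  let ?S = "\<lambda>(h, \<Phi>) f. \<Union>j\<in>J. B #> (\<sigma> j f \<otimes> h)"
  let ?q = "\<lambda>(h, \<Phi>) f v. if \<exists>j\<in>J. v = \<sigma> j f \<otimes> h then Some (SOME j. j \<in> J \<and> v = \<sigma> j f \<otimes> h) else None"
  have card_A: "card ?A = Suc (card J)"
    using J_fin by (subst card_insert_disjoint) (auto simp: card_image)
  interpret bc: block_constraints ?A ?I snd ?S ?q "card J * card B" "card J * card B * N ^ 3" N \<beta> \<rho>
  proof
    show "finite ?A" using J_fin by simp
    show "0 < N" "0 < \<beta>" "0 \<le> \<rho>" "\<rho> \<le> 1" by (fact N_pos \<beta>_pos \<rho>_le)+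
    show "real (card ?A ^ s) - 1 \<le> \<rho> * \<beta> ^ s" if "s \<le> card J * card B" for s
      unfolding card_A by (rule block_bound[OF that])
    show "\<beta> + real (card J * card B * N ^ 3) * \<beta> * \<rho> ^ N \<le> real (card ?A)"
      unfolding card_A by (rule gap)
  next
    fix i assume "i \<in> ?I"
    then obtain h \<Phi> where i: "i = (h, \<Phi>)" "h \<in> carrier G" "\<Phi> \<in> \<S> h" by auto
    show "finite (snd i)" "N \<le> card (snd i)"
      using \<Phi>[OF i(2,3)] F_fin i(1) by (auto intro: finite_subset)
    fix f assume "f \<in> snd i"
    then have f: "f \<in> F" using \<Phi>[OF i(2,3)] i(1) by auto
    show "finite (?S i f)" using J_fin B_fin by (auto simp: i(1) finite_r_coset)
    have "card (?S i f) \<le> (\<Sum>j\<in>J. card (B #> (\<sigma> j f \<otimes> h)))"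
      using J_fin by (simp add: i(1) card_UN_le)
    also have "\<dots> \<le> (\<Sum>j\<in>J. card B)"
    proof (rule sum_mono)
      fix j assume "j \<in> J"
      have "B #> (\<sigma> j f \<otimes> h) = (\<lambda>b. b \<otimes> (\<sigma> j f \<otimes> h)) ` B" by (auto simp: r_coset_def)
      then show "card (B #> (\<sigma> j f \<otimes> h)) \<le> card B" using card_image_le[OF B_fin] by metis
    qed
    finally show "card (?S i f) \<le> card J * card B" by simp
    show "?q i f v \<in> ?A" for v
    proof (cases "\<exists>j\<in>J. v = \<sigma> j f \<otimes> h")
      case True
      then have "\<exists>j. j \<in> J \<and> v = \<sigma> j f \<otimes> h" by blast
      from someI_ex[OF this] show ?thesis using True by (simp add: i(1))
    qed (simp add: i(1))
    fix f' assume "f' \<in> snd i" "f \<noteq> f'"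
    then have f': "f' \<in> F" using \<Phi>[OF i(2,3)] i(1) by auto
    show "?S i f \<inter> ?S i f' = {}"
    proof (rule ccontr)
      assume "?S i f \<inter> ?S i f' \<noteq> {}"
      then obtain j j' b b' where jb: "j \<in> J" "j' \<in> J" "b \<in> B" "b' \<in> B"
        "b \<otimes> (\<sigma> j f \<otimes> h) = b' \<otimes> (\<sigma> j' f' \<otimes> h)"
        by (auto simp: i(1) r_coset_def)
      then have "(b \<otimes> \<sigma> j f) \<otimes> h = (b' \<otimes> \<sigma> j' f') \<otimes> h"
        using f f' i(2) \<sigma>_carrier B_carrier by (auto simp: m_assoc subset_iff)
      then have "b \<otimes> \<sigma> j f = b' \<otimes> \<sigma> j' f'"
        using f f' i(2) jb \<sigma>_carrier B_carrier by (auto simp: subset_iff)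
      then show False using spread[OF f f' \<open>f \<noteq> f'\<close> jb(1,2)] jb(3,4) by (auto simp: r_coset_def)
    qed
  next
    fix v
    let ?X = "{i \<in> ?I. v \<in> (\<Union>f\<in>snd i. ?S i f)}"
    let ?H = "(\<lambda>(f, j, b). inv (b \<otimes> \<sigma> j f) \<otimes> v) ` (F \<times> J \<times> B) \<inter> carrier G"
    have sub: "?X \<subseteq> Sigma ?H \<S>"
    proof clarsimp
      fix h \<Phi> f j assume *: "h \<in> carrier G" "\<Phi> \<in> \<S> h" "f \<in> \<Phi>" "j \<in> J" "v \<in> B #> (\<sigma> j f \<otimes> h)"
      have f: "f \<in> F" using \<Phi>[OF *(1,2)] *(3) by auto
      obtain b where b: "b \<in> B" "v = b \<otimes> (\<sigma> j f \<otimes> h)" using *(5) by (auto simp: r_coset_def)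
      have "v = (b \<otimes> \<sigma> j f) \<otimes> h" using b f * \<sigma>_carrier B_carrier by (auto simp: m_assoc subset_iff)
      then have "h = inv (b \<otimes> \<sigma> j f) \<otimes> v"
        using b(1) f * \<sigma>_carrier B_carrier by (auto simp: subset_iff inv_solve_left)
      then show "h \<in> (\<lambda>(f, j, b). inv (b \<otimes> \<sigma> j f) \<otimes> v) ` (F \<times> J \<times> B)"
        using f *(4) b(1) by (intro image_eqI[of _ _ "(f, j, b)"]) auto
    qed
    have fin_H: "finite ?H" using F_fin J_fin B_fin by auto
    have fin: "finite (Sigma ?H \<S>)" using fin_H S by (intro finite_SigmaI) auto
    show "finite ?X" by (rule finite_subset[OF sub fin])
    have "card ?X \<le> card (Sigma ?H \<S>)" by (rule card_mono[OF fin sub])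
    also have "\<dots> = (\<Sum>h\<in>?H. card (\<S> h))" using fin_H S by (intro card_SigmaI) auto
    also have "\<dots> \<le> card ?H * N" using S by (intro sum_bounded_above[where K = N, simplified]) auto
    also have "card ?H \<le> card F * (card J * card B)"
      using F_fin J_fin B_fin
      by (intro order.trans[OF card_mono[OF _ Int_lower1]] order.trans[OF card_image_le])
        (auto simp: card_cartesian_product)
    finally show "card ?X \<le> card J * card B * N ^ 3"
      by (simp add: card_F power3_eq_cube algebra_simps)
  qed
  obtain l where l: "\<And>v. l v \<in> ?A" "\<And>i. i \<in> ?I \<Longrightarrow> bc.sat l i" using bc.ex_sat by blast
  have "\<exists>f\<in>\<Phi>. \<forall>j\<in>J. l (\<sigma> j f \<otimes> h) = Some j \<and>
       (\<forall>v\<in>B #> (\<sigma> j f \<otimes> h). v \<noteq> \<sigma> j f \<otimes> h \<longrightarrow> l v = None)"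
    if h: "h \<in> carrier G" and \<Phi>h: "\<Phi> \<in> \<S> h" for h \<Phi>
  proof -
    have "bc.sat l (h, \<Phi>)" using h \<Phi>h by (intro l(2)) auto
    then obtain f where f: "f \<in> \<Phi>" "\<And>j v. j \<in> J \<Longrightarrow> v \<in> B #> (\<sigma> j f \<otimes> h) \<Longrightarrow> l v = ?q (h, \<Phi>) f v"
      unfolding bc.sat_def by auto
    have fF: "f \<in> F" using f(1) \<Phi>[OF h \<Phi>h] by auto
    have inj: "i = j" if "i \<in> J" "j \<in> J" "\<sigma> i f \<otimes> h = \<sigma> j f \<otimes> h" for i j
      using that \<sigma>_distinct[OF fF] \<sigma>_carrier[OF _ fF] h by auto
    show ?thesis
    proof (intro bexI[OF _ f(1)] ballI conjI impI)
      fix j assume j: "j \<in> J"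
      have "(SOME i. i \<in> J \<and> \<sigma> j f \<otimes> h = \<sigma> i f \<otimes> h) = j"
        using j inj by (intro some_equality) auto
      then show "l (\<sigma> j f \<otimes> h) = Some j"
        using f(2)[OF j self_r_coset] j \<sigma>_mult_carrier[OF j fF h] by auto
      fix v assume v: "v \<in> B #> (\<sigma> j f \<otimes> h)" "v \<noteq> \<sigma> j f \<otimes> h"
      have "v \<noteq> \<sigma> i f \<otimes> h" if i: "i \<in> J" for i
      proof
        assume eq: "v = \<sigma> i f \<otimes> h"
        then have "i \<noteq> j" using v(2) by auto
        obtain b where b: "b \<in> B" "\<sigma> i f \<otimes> h = b \<otimes> (\<sigma> j f \<otimes> h)"
          using v(1) eq by (auto simp: r_coset_def)
        then have "\<sigma> i f \<otimes> h = (b \<otimes> \<sigma> j f) \<otimes> h"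
          using \<sigma>_carrier[OF j fF] B_carrier h by (auto simp: m_assoc subset_iff)
        then have "\<sigma> i f = b \<otimes> \<sigma> j f"
          using \<sigma>_carrier[OF j fF] \<sigma>_carrier[OF i fF] B_carrier h b by (auto simp: subset_iff)
        then show False using consistent[OF fF j i] \<open>i \<noteq> j\<close> b(1) by (auto simp: r_coset_def)
      qed
      then show "l v = None" using f(2)[OF j v(1)] by auto
    qed
  qed
  then show ?thesis using l(1) by blast
qed

definition placed :: "('g \<Rightarrow> bool) \<Rightarrow> 'g set \<Rightarrow> nat \<Rightarrow> 'g \<Rightarrow> bool" where
  "placed x R j g \<longleftrightarrow> (\<forall>w\<in>P j. w \<otimes> g \<in> R \<and> x (w \<otimes> g) = y j w)"

text \<open>The element \<open>f\<close> can still be used for \<open>h\<close> after \<open>x\<close> has been cut along \<open>R\<close>.\<close>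
definition avail :: "('g \<Rightarrow> bool) \<Rightarrow> 'g set \<Rightarrow> 'g \<Rightarrow> 'g \<Rightarrow> bool" where
  "avail x R f h \<longleftrightarrow>
    (\<forall>j\<in>J. placed x R j (\<sigma> j f \<otimes> h) \<or> (U #> (\<sigma> j f \<otimes> h)) \<inter> R = {})"

definition hit :: "('g \<Rightarrow> bool) \<Rightarrow> 'g set \<Rightarrow> 'g \<Rightarrow> bool" where
  "hit x R h \<longleftrightarrow> (\<exists>f\<in>F. \<forall>j\<in>J. placed x R j (\<sigma> j f \<otimes> h))"

text \<open>
  A cut must not destroy the chance to serve any \<open>h\<close>: either \<open>h\<close> is served inside
  \<open>R\<close>, or \<open>N\<close> elements of \<open>F\<close> remain usable, which suffices for filling
  in the outside by \<open>ex_labelling\<close>.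
\<close>
definition cut' :: "('g \<Rightarrow> bool) \<Rightarrow> 'g set \<Rightarrow> bool" where
  "cut' x R \<longleftrightarrow> cut x R \<and> (\<forall>h\<in>carrier G. hit x R h \<or> N \<le> card {f\<in>F. avail x R f h})"

definition T :: "'g set" where
  "T = (\<Union>f\<in>F. \<Union>j\<in>J. U #> \<sigma> j f)"

text \<open>The second part accounts for copies swallowed at the boundary of a window; the third part
  ensures that all elements of \<open>F\<close> are usable for \<open>h\<close> if one of them touches a piece far away
  from the window.\<close>
definition K' :: "'g set" where
  "K' = K \<union> (K <#> (K <#> ((\<Union>j\<in>J. P j) <#> (m_inv G ` U <#> K)))) \<union> (T <#> m_inv G ` T)"

lemma P_carrier: "j \<in> J \<Longrightarrow> P j \<subseteq> carrier G" and P_fin: "j \<in> J \<Longrightarrow> finite (P j)"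
  using template cut_carrier cut_fin by blast+

lemma T_carrier: "T \<subseteq> carrier G" and T_fin: "finite T"
proof -
  show "T \<subseteq> carrier G" unfolding T_def using r_coset_subset_G[OF U_carrier] \<sigma>_carrier by blast
  show "finite T" unfolding T_def using F_fin J_fin U_fin by (auto intro: finite_r_coset)
qed

lemma inv_image_carrier: "A \<subseteq> carrier G \<Longrightarrow> m_inv G ` A \<subseteq> carrier G"
  by auto

lemma U_coset_T: "f \<in> F \<Longrightarrow> j \<in> J \<Longrightarrow> h \<in> carrier G \<Longrightarrow> U #> (\<sigma> j f \<otimes> h) \<subseteq> T #> h"
proof -
  assume *: "f \<in> F" "j \<in> J" "h \<in> carrier G"
  have "U #> (\<sigma> j f \<otimes> h) = (U #> \<sigma> j f) #> h"
    using coset_mult_assoc[OF U_carrier \<sigma>_carrier[OF *(2,1)] *(3)] by simp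
  also have "\<dots> \<subseteq> T #> h" using * by (auto simp: T_def r_coset_def)
  finally show ?thesis .
qed

lemma K'_fin: "finite K'"
  unfolding K'_def using K_fin U_fin T_fin J_fin P_fin by (auto intro!: finite_set_mult)

lemma PP_carrier: "(\<Union>j\<in>J. P j) \<subseteq> carrier G"
  using P_carrier by blast

lemma K'_carrier: "K' \<subseteq> carrier G"
  unfolding K'_def
  by (intro Un_least set_mult_closed K_carrier inv_image_carrier U_carrier T_carrier PP_carrier)

lemma K_K': "K \<subseteq> K'" by (auto simp: K'_def)

lemma one_K': "\<one> \<in> K'" using one_K K_K' by blast

lemma meets_coset:
  assumes "A \<subseteq> carrier G" "h \<in> carrier G" "R \<subseteq> carrier G" "(A #> h) \<inter> R \<noteq> {}"
  shows "h \<in> m_inv G ` A <#> R"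
proof -
  obtain a where a: "a \<in> A" "a \<otimes> h \<in> R" using assms(4) by (auto simp: r_coset_def)
  then have "h = inv a \<otimes> (a \<otimes> h)" using assms by (simp add: subset_iff flip: m_assoc)
  then show ?thesis using a unfolding set_mult_def by blast
qed

lemma T_coset_K':
  assumes "h \<in> carrier G" "R \<subseteq> carrier G" "(T #> h) \<inter> R \<noteq> {}"
  shows "T #> h \<subseteq> K' <#> R"
proof -
  have "h \<in> m_inv G ` T <#> R" by (rule meets_coset[OF T_carrier assms])
  then have "T #> h \<subseteq> T <#> (m_inv G ` T <#> R)" by (auto simp: r_coset_def set_mult_def)
  also have "\<dots> = (T <#> m_inv G ` T) <#> R"
    by (rule set_mult_assoc[symmetric]) (auto simp: assms T_carrier inv_image_carrier)
  also have "\<dots> \<subseteq> K' <#> R" by (rule mono_set_mult) (auto simp: K'_def)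
  finally show ?thesis .
qed

lemma K_P_coset: "j \<in> J \<Longrightarrow> c \<in> carrier G \<Longrightarrow> K <#> (P j #> c) \<subseteq> U #> c"
proof -
  assume *: "j \<in> J" "c \<in> carrier G"
  have "K <#> (P j #> c) = (K <#> P j) #> c"
    using setmult_rcos_assoc[OF K_carrier P_carrier[OF *(1)] *(2)] by simp
  also have "\<dots> \<subseteq> U #> c" using KP_U[OF *(1)] by (auto simp: r_coset_def)
  finally show ?thesis .
qed

lemma self_U_coset: "g \<in> carrier G \<Longrightarrow> g \<in> U #> g"
  using one_U by (force simp: r_coset_def)

lemma placed_shift:
  assumes "g \<in> carrier G" "s \<in> carrier G" "R \<subseteq> carrier G" "j \<in> J"
  shows "placed (shift g x) (R #> inv g) j s \<longleftrightarrow> placed x R j (s \<otimes> g)"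
proof -
  have "w \<otimes> s \<in> R #> inv g \<longleftrightarrow> w \<otimes> (s \<otimes> g) \<in> R" if "w \<in> P j" for w
  proof -
    have w: "w \<in> carrier G" using P_carrier assms(4) that by blast
    show ?thesis
    proof
      assume "w \<otimes> s \<in> R #> inv g"
      then obtain r where r: "r \<in> R" "w \<otimes> s = r \<otimes> inv g" by (auto simp: r_coset_def)
      then have "w \<otimes> (s \<otimes> g) = r \<otimes> inv g \<otimes> g" using w assms by (simp flip: m_assoc)
      then show "w \<otimes> (s \<otimes> g) \<in> R" using r assms by (auto simp: m_assoc subset_iff)
    next
      assume "w \<otimes> (s \<otimes> g) \<in> R"
      moreover have "w \<otimes> s = w \<otimes> (s \<otimes> g) \<otimes> inv g" using w assms by (simp add: m_assoc)
      ultimately show "w \<otimes> s \<in> R #> inv g" unfolding r_coset_def by blast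
    qed
  qed
  moreover have "shift g x (w \<otimes> s) = x (w \<otimes> (s \<otimes> g))" if "w \<in> P j" for w
    using that P_carrier[OF assms(4)] assms by (auto simp: shift_def m_assoc)
  ultimately show ?thesis by (simp add: placed_def)
qed

lemma coset_disjoint_shift:
  assumes "g \<in> carrier G" "s \<in> carrier G" "R \<subseteq> carrier G"
  shows "(U #> s) \<inter> (R #> inv g) = {} \<longleftrightarrow> (U #> (s \<otimes> g)) \<inter> R = {}"
proof -
  have "(U #> s) \<inter> (R #> inv g) \<noteq> {} \<longleftrightarrow> (\<exists>u\<in>U. \<exists>r\<in>R. u \<otimes> s = r \<otimes> inv g)"
    by (auto simp: r_coset_def)
  also have "\<dots> \<longleftrightarrow> (\<exists>u\<in>U. \<exists>r\<in>R. u \<otimes> (s \<otimes> g) = r)"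
  proof (intro bex_cong refl)
    fix u r assume "u \<in> U" "r \<in> R"
    then have "u \<in> carrier G" "r \<in> carrier G" using U_carrier assms by auto
    then show "(u \<otimes> s = r \<otimes> inv g) = (u \<otimes> (s \<otimes> g) = r)"
      using assms by (metis inv_solve_right' m_assoc m_closed inv_closed inv_solve_right)
  qed
  also have "\<dots> \<longleftrightarrow> (U #> (s \<otimes> g)) \<inter> R \<noteq> {}" by (auto simp: r_coset_def)
  finally show ?thesis by blast
qed

lemma cut'_shift:
  assumes "cut' x R" "g \<in> carrier G"
  shows "cut' (shift g x) (R #> inv g)"
proof -
  have R: "R \<subseteq> carrier G" using assms cut_carrier unfolding cut'_def by blast
  have hit: "hit (shift g x) (R #> inv g) h \<longleftrightarrow> hit x R (h \<otimes> g)"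
    and av: "f \<in> F \<Longrightarrow> avail (shift g x) (R #> inv g) f h \<longleftrightarrow> avail x R f (h \<otimes> g)"
    if h: "h \<in> carrier G" for h f
  proof -
    have a: "\<sigma> j f \<otimes> (h \<otimes> g) = \<sigma> j f \<otimes> h \<otimes> g" if "j \<in> J" "f \<in> F" for j f
      using that \<sigma>_carrier h assms by (simp add: m_assoc)
    show "hit (shift g x) (R #> inv g) h \<longleftrightarrow> hit x R (h \<otimes> g)"
      unfolding hit_def using a h assms
      by (intro bex_cong ball_cong refl) (simp add: placed_shift R \<sigma>_mult_carrier)
    show "avail (shift g x) (R #> inv g) f h \<longleftrightarrow> avail x R f (h \<otimes> g)" if "f \<in> F"
      unfolding avail_def using a h assms that
      by (intro ball_cong refl) (simp add: placed_shift coset_disjoint_shift R \<sigma>_mult_carrier)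
  qed
  have "{f\<in>F. avail (shift g x) (R #> inv g) f h} = {f\<in>F. avail x R f (h \<otimes> g)}"
    if "h \<in> carrier G" for h
    using av[OF that] by blast
  then show ?thesis using assms hit cut_shift unfolding cut'_def by simp
qed

text \<open>A set of two elements spoils at most \<open>2 * card J * card U\<close> of the \<open>N * N\<close> elements of \<open>F\<close>.\<close>
lemma cut'_small:
  assumes R: "finite R" "R \<subseteq> carrier G" "card R \<le> 2"
  shows "cut' x R"
proof -
  have "N \<le> card {f\<in>F. avail x R f h}" if h: "h \<in> carrier G" for h
  proof -
    let ?X = "m_inv G ` U <#> R"
    let ?Z = "\<lambda>j. {f\<in>F. \<sigma> j f \<otimes> h \<in> ?X}"
    have X_fin: "finite ?X" using U_fin R by (intro finite_set_mult) auto
    have "?X = (\<lambda>(u, r). inv u \<otimes> r) ` (U \<times> R)" by (auto simp: set_mult_def)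
    then have "card ?X \<le> card (U \<times> R)" using U_fin R by (metis card_image_le finite_cartesian_product)
    also have "\<dots> \<le> card U * 2" using R by (simp add: card_cartesian_product)
    finally have card_X: "card ?X \<le> card U * 2" .
    have Z: "card (?Z j) \<le> card U * 2" if j: "j \<in> J" for j
    proof -
      have "inj_on (\<lambda>f. \<sigma> j f \<otimes> h) (?Z j)"
        using \<sigma>_inj[OF j] \<sigma>_carrier[OF j] h by (auto simp: inj_on_def)
      then have "card (?Z j) \<le> card ?X" by (rule card_inj_on_le) (auto simp: X_fin)
      then show ?thesis using card_X by simp
    qed
    have "F - {f\<in>F. avail x R f h} \<subseteq> (\<Union>j\<in>J. ?Z j)"
    proof
      fix f assume "f \<in> F - {f\<in>F. avail x R f h}"
      then obtain j where "f \<in> F" "j \<in> J" "(U #> (\<sigma> j f \<otimes> h)) \<inter> R \<noteq> {}"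
        by (auto simp: avail_def)
      then show "f \<in> (\<Union>j\<in>J. ?Z j)"
        using meets_coset[OF U_carrier _ R(2)] \<sigma>_mult_carrier h by blast
    qed
    then have "card (F - {f\<in>F. avail x R f h}) \<le> card (\<Union>j\<in>J. ?Z j)"
      using F_fin J_fin by (intro card_mono) auto
    also have "\<dots> \<le> (\<Sum>j\<in>J. card (?Z j))" by (rule card_UN_le[OF J_fin])
    also have "\<dots> \<le> card J * (card U * 2)" using Z by (intro sum_bounded_above[where K = "card U * 2", simplified])
    finally have "card F - card {f\<in>F. avail x R f h} \<le> card J * (card U * 2)"
      using F_fin by (simp add: card_Diff_subset)
    then show ?thesis using N_large card_F by linarith
  qed
  then show ?thesis using cut_small[OF R] unfolding cut'_def by blast
qed

text \<open>
  The pieces are first supplemented by copies of the templates. An \<open>h\<close> touched by a piece is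
  touched by no other piece; if it is not served there, it is served by one of its \<open>N\<close> usable
  elements. An \<open>h\<close> touched by no piece receives copies from each of the \<open>N\<close> parts of
  \<open>F\<close>. The enlarged family is separated and is glued with respect to the old \<open>cut\<close>.

  The surplus of \<open>N\<close> copies makes the new point cuttable along clean windows \<open>W\<close>. All
  copies near \<open>W\<close> are swallowed, so each of the \<open>N\<close> copies serving \<open>h\<close>
  lies either completely inside the resulting set or so far outside that its place remains usable. For an
  \<open>h\<close> touched by a piece there may be a single copy, but cleanness keeps that copy completely on
  one side.
\<close>
lemma cut'_glue:
  assumes cutI: "\<forall>p\<in>\<I>. cut' (fst p) (snd p)" and sep: "separated K' \<I>"
  shows "\<exists>x. (\<forall>p\<in>\<I>. \<forall>r\<in>snd p. x r = fst p r) \<and>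
          (\<forall>W. finite W \<longrightarrow> W \<subseteq> carrier G \<longrightarrow> clean K' \<I> W \<longrightarrow>
            (\<exists>R. W \<subseteq> R \<and> R \<subseteq> K' <#> W \<and> cut' x R))"
proof -
  have cut_I: "cut (fst p) (snd p)" if "p \<in> \<I>" for p using cutI that unfolding cut'_def by blast
  have I_carrier: "snd p \<subseteq> carrier G" if "p \<in> \<I>" for p using cut_carrier[OF cut_I[OF that]] .
  have K_sub_K': "K <#> W \<subseteq> K' <#> W" for W by (rule mono_set_mult[OF K_K' order_refl])
  have sub_K': "W \<subseteq> K' <#> W" if "W \<subseteq> carrier G" for W by (rule subset_set_mult[OF one_K' that])
  have K'_mult_carrier: "K' <#> W \<subseteq> carrier G" if "W \<subseteq> carrier G" for W
    by (rule set_mult_closed[OF K'_carrier that])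
  define touch where "touch h p \<longleftrightarrow> (T #> h) \<inter> snd p \<noteq> {}" for h and p :: "('g \<Rightarrow> bool) \<times> 'g set"
  have touch_unique: "p = p'" if h: "h \<in> carrier G" and p: "p \<in> \<I>" "p' \<in> \<I>" "touch h p" "touch h p'" for h p p'
  proof (rule ccontr)
    assume "p \<noteq> p'"
    from p(4) obtain v where v: "v \<in> T #> h" "v \<in> snd p'" unfolding touch_def by blast
    have "T #> h \<subseteq> K' <#> snd p"
      using T_coset_K'[OF h I_carrier[OF p(1)]] p(3) unfolding touch_def by blast
    then have "v \<in> K' <#> (K' <#> snd p)"
      using v(1) sub_K'[OF K'_mult_carrier[OF I_carrier[OF p(1)]]] by blast
    moreover have "v \<in> K' <#> snd p'" using v(2) sub_K'[OF I_carrier[OF p(2)]] by blast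
    ultimately show False using separatedD[OF sep p(1,2) \<open>p \<noteq> p'\<close>] by blast
  qed
  have avail_untouched: "avail x R f h"
    if "f \<in> F" "h \<in> carrier G" "(T #> h) \<inter> R = {}" for x R f h
    unfolding avail_def using U_coset_T[OF that(1) _ that(2)] that(3) by blast
  obtain part :: "nat \<Rightarrow> 'g set" where part: "\<And>i. i < N \<Longrightarrow> part i \<subseteq> F \<and> card (part i) = N"
    and part_disjoint: "\<And>i j. i < N \<Longrightarrow> j < N \<Longrightarrow> i \<noteq> j \<Longrightarrow> part i \<inter> part j = {}"
  proof -
    have "card ({..<N} \<times> {..<N}) = card F" by (simp add: card_F)
    then obtain e where e: "bij_betw e ({..<N} \<times> {..<N}) F"
      using F_fin finite_same_card_bij[of "{..<N} \<times> {..<N}" F] by auto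
    show ?thesis
    proof (rule that[of "\<lambda>i. e ` ({i} \<times> {..<N})"])
      fix i assume i: "i < N"
      have "inj_on e ({i} \<times> {..<N})" using e i by (auto simp: bij_betw_def intro: inj_on_subset)
      then show "e ` ({i} \<times> {..<N}) \<subseteq> F \<and> card (e ` ({i} \<times> {..<N})) = N"
        using e i by (auto simp: bij_betw_def card_image card_cartesian_product)
      fix j assume "j < N" "i \<noteq> j"
      then show "e ` ({i} \<times> {..<N}) \<inter> e ` ({j} \<times> {..<N}) = {}"
        using e i by (auto simp: bij_betw_def inj_on_def)
    qed
  qed
  \<comment> \<open>The sets of elements of \<open>F\<close> that have to be hit by the labelling, for each \<open>h\<close>.\<close>
  define \<Phi> where "\<Phi> h = {f\<in>F. \<forall>p\<in>\<I>. touch h p \<longrightarrow> avail (fst p) (snd p) f h}" for h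
  define \<S> where "\<S> h = (if \<exists>p\<in>\<I>. touch h p
     then (if \<exists>p\<in>\<I>. touch h p \<and> hit (fst p) (snd p) h then {} else {\<Phi> h})
     else part ` {..<N})" for h
  have \<Phi>_eq: "\<Phi> h = {f\<in>F. avail (fst p) (snd p) f h}"
    if "h \<in> carrier G" "p \<in> \<I>" "touch h p" for h p
    unfolding \<Phi>_def using touch_unique[OF that(1)] that by blast
  have \<S>_fin: "finite (\<S> h) \<and> card (\<S> h) \<le> N" for h
    using N_pos card_image_le[of "{..<N}" part] by (auto simp: \<S>_def)
  have \<S>_card: "\<Psi> \<subseteq> F \<and> N \<le> card \<Psi>" if h: "h \<in> carrier G" and \<Psi>: "\<Psi> \<in> \<S> h" for h \<Psi>
  proof (cases "\<exists>p\<in>\<I>. touch h p")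
    case True
    then obtain p where p: "p \<in> \<I>" "touch h p" by blast
    have no: "\<not> hit (fst p) (snd p) h" and eq: "\<Psi> = \<Phi> h"
      using \<Psi> p unfolding \<S>_def by (auto split: if_splits)
    have "N \<le> card (\<Phi> h)" using cutI p no h unfolding \<Phi>_eq[OF h p] cut'_def by blast
    then show ?thesis unfolding eq by (auto simp: \<Phi>_def)
  next
    case False
    then show ?thesis using \<Psi> part by (auto simp: \<S>_def)
  qed
  obtain l where l_hit: "\<forall>h\<in>carrier G. \<forall>\<Psi>\<in>\<S> h. \<exists>f\<in>\<Psi>. \<forall>j\<in>J. l (\<sigma> j f \<otimes> h) = Some j \<and>
       (\<forall>v\<in>B #> (\<sigma> j f \<otimes> h). v \<noteq> \<sigma> j f \<otimes> h \<longrightarrow> l v = None)"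
    using ex_labelling[of \<S>] \<S>_fin \<S>_card by blast
  \<comment> \<open>Proposed copies whose \<open>B\<close>-zone is free of other labels and whose \<open>U\<close>-zone avoids all pieces.\<close>
  define C where "C = {(c, j). c \<in> carrier G \<and> j \<in> J \<and> l c = Some j \<and>
     (\<forall>v\<in>B #> c. v \<noteq> c \<longrightarrow> l v = None) \<and> (\<forall>p\<in>\<I>. (U #> c) \<inter> snd p = {})}"
  have C: "c \<in> carrier G" "j \<in> J" "\<And>p. p \<in> \<I> \<Longrightarrow> (U #> c) \<inter> snd p = {}" if "(c, j) \<in> C" for c j
    using that unfolding C_def by auto
  have C_apart: "(U #> c) \<inter> (K <#> (K <#> (P j' #> c'))) = {}"
    if cj: "(c, j) \<in> C" "(c', j') \<in> C" "(c, j) \<noteq> (c', j')" for c j c' j'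
  proof (rule B_apart)
    have "c \<noteq> c'" using cj unfolding C_def by auto
    moreover have "l c' \<noteq> None" using cj(2) unfolding C_def by auto
    ultimately show "c' \<notin> B #> c" using cj(1) unfolding C_def by auto
  qed (use C cj in auto)
  define piece where "piece = (\<lambda>(c, j). (shift (inv c) (y j), P j #> c))"
  let ?I = "\<I> \<union> piece ` C"
  have coset_carrier: "P j #> c \<subseteq> carrier G" if "(c, j) \<in> C" for c j
    using r_coset_subset_G P_carrier C(1,2)[OF that] by blast
  have cut2: "\<forall>p\<in>?I. cut (fst p) (snd p)"
  proof -
    have "cut (shift (inv c) (y j)) (P j #> c)" if "(c, j) \<in> C" for c j
      using cut_shift[OF template, of j "inv c"] C(1,2)[OF that] by simp
    then show ?thesis using cut_I by (auto simp: piece_def)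
  qed
  have sep2: "separated K ?I"
    unfolding separated_def
  proof (intro ballI impI)
    fix p p' assume p: "p \<in> ?I" "p' \<in> ?I" "p \<noteq> p'"
    show "(K <#> (K <#> snd p)) \<inter> (K <#> snd p') = {}"
    proof (cases "p \<in> \<I>")
      case pI: True
      show ?thesis
      proof (cases "p' \<in> \<I>")
        case True
        have "K <#> (K <#> snd p) \<subseteq> K' <#> (K' <#> snd p)"
          by (intro mono_set_mult K_K' K_sub_K')
        then show ?thesis using separatedD[OF sep pI True p(3)] K_sub_K'[of "snd p'"] by blast
      next
        case False
        then obtain c j where c: "(c, j) \<in> C" "p' = piece (c, j)" using p(2) by auto
        then show ?thesis
          using U_apart[OF C(2,1)[OF c(1)] I_carrier[OF pI] C(3)[OF c(1) pI]] by (simp add: piece_def)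
      qed
    next
      case False
      then obtain c j where c: "(c, j) \<in> C" "p = piece (c, j)" using p(1) by auto
      show ?thesis
      proof (cases "p' \<in> \<I>")
        case True
        then show ?thesis
          using U_apart[OF C(2,1)[OF c(1)] I_carrier[OF True] C(3)[OF c(1) True]] c(2) by (simp add: piece_def)
      next
        case False
        then obtain c' j' where c': "(c', j') \<in> C" "p' = piece (c', j')" using p(2) by auto
        have "(U #> c') \<inter> (K <#> (K <#> (P j #> c))) = {}"
          using C_apart[OF c'(1) c(1)] p(3) c c' by auto
        then show ?thesis using K_P_coset[OF C(2,1)[OF c'(1)]] c(2) c'(2) by (auto simp: piece_def)
      qed
    qed
  qed
  obtain x where x: "\<forall>p\<in>?I. \<forall>r\<in>snd p. x r = fst p r"
    and ext: "\<forall>W. finite W \<longrightarrow> W \<subseteq> carrier G \<longrightarrow> clean K ?I W \<longrightarrow>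
            (\<exists>R. W \<subseteq> R \<and> R \<subseteq> K <#> W \<and> cut x R)"
    using glue[OF cut2 sep2] by (elim exE conjE)
  have x_piece: "x (w \<otimes> c) = y j w" if "(c, j) \<in> C" "w \<in> P j" for c j w
  proof -
    have "w \<otimes> c \<in> snd (piece (c, j))" using that(2) by (auto simp: piece_def r_coset_def)
    then have "x (w \<otimes> c) = fst (piece (c, j)) (w \<otimes> c)" using x that(1) by blast
    also have "\<dots> = y j (w \<otimes> c \<otimes> inv c)" by (simp add: piece_def shift_def)
    also have "w \<otimes> c \<otimes> inv c = w"
      using C(1)[OF that(1)] P_carrier[OF C(2)[OF that(1)]] that(2) by (simp add: m_assoc subset_iff)
    finally show ?thesis .
  qed
  have C_free: "\<exists>f\<in>\<Psi>. \<forall>j\<in>J. (\<sigma> j f \<otimes> h, j) \<in> C \<or>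
      (\<exists>p\<in>\<I>. (U #> (\<sigma> j f \<otimes> h)) \<inter> snd p \<noteq> {})"
    if h: "h \<in> carrier G" and \<Psi>: "\<Psi> \<in> \<S> h" for h \<Psi>
  proof -
    obtain f where f: "f \<in> \<Psi>" "\<forall>j\<in>J. l (\<sigma> j f \<otimes> h) = Some j \<and>
       (\<forall>v\<in>B #> (\<sigma> j f \<otimes> h). v \<noteq> \<sigma> j f \<otimes> h \<longrightarrow> l v = None)"
      using l_hit h \<Psi> by blast
    then have "f \<in> F" using \<S>_card[OF h \<Psi>] by blast
    then show ?thesis
      using f \<sigma>_mult_carrier[OF _ _ h] unfolding C_def by (intro bexI[of _ f]) auto
  qed
  have "\<exists>R. W \<subseteq> R \<and> R \<subseteq> K' <#> W \<and> cut' x R"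
    if W: "finite W" "W \<subseteq> carrier G" and clean: "clean K' \<I> W" for W
  proof -
    \<comment> \<open>The copies close to \<open>W\<close>, which are added to the window.\<close>
    define D where "D = {(c, j). (c, j) \<in> C \<and> (U #> c) \<inter> (K <#> W) \<noteq> {}}"
    define W1 where "W1 = W \<union> (\<Union>(c, j)\<in>D. K <#> (P j #> c))"
    have D: "(c, j) \<in> C" "(U #> c) \<inter> (K <#> W) \<noteq> {}" if "(c, j) \<in> D" for c j
      using that unfolding D_def by auto
    let ?Q = "(\<Union>j\<in>J. P j) <#> (m_inv G ` U <#> (K <#> W))"
    have KW: "K <#> W \<subseteq> carrier G" by (rule K_mult_carrier[OF W(2)])
    have coset_Q: "P j #> c \<subseteq> ?Q" if "(c, j) \<in> D" for c j
    proof -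
      have "c \<in> m_inv G ` U <#> (K <#> W)"
        using meets_coset[OF U_carrier _ KW D(2)[OF that]] C(1)[OF D(1)[OF that]] by blast
      moreover have "P j \<subseteq> (\<Union>j\<in>J. P j)" using C(2)[OF D(1)[OF that]] by blast
      ultimately show ?thesis by (intro coset_subset_set_mult)
    qed
    have "K <#> (P j #> c) \<subseteq> K <#> ?Q" if "(c, j) \<in> D" for c j
      by (rule mono_set_mult[OF order_refl coset_Q[OF that]])
    then have "W1 \<subseteq> W \<union> (K <#> ?Q)" unfolding W1_def by blast
    moreover have "finite ?Q"
      using J_fin P_fin U_fin K_fin W(1) by (intro finite_set_mult) auto
    ultimately have W1_fin: "finite W1"
      using W(1) K_fin finite_set_mult by (metis finite_UnI finite_subset)
    have "K <#> (P j #> c) \<subseteq> carrier G" if "(c, j) \<in> D" for c j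
      by (rule K_mult_carrier[OF coset_carrier[OF D(1)[OF that]]])
    then have W1_carrier: "W1 \<subseteq> carrier G" unfolding W1_def using W(2) by blast
    have KW1: "K <#> W1 = (K <#> W) \<union> (\<Union>(c, j)\<in>D. K <#> (K <#> (P j #> c)))"
      unfolding W1_def set_mult_Un set_mult_UN by (auto simp: case_prod_beta)
    have clean1: "clean K ?I W1"
      unfolding clean_def
    proof (intro ballI disjCI)
      fix p assume p: "p \<in> ?I" and meets: "(K <#> snd p) \<inter> (K <#> W1) \<noteq> {}"
      show "K <#> snd p \<subseteq> W1"
      proof (cases "p \<in> \<I>")
        case True
        have "(K <#> snd p) \<inter> (K <#> (K <#> (P j #> c))) = {}" if "(c, j) \<in> D" for c j
          using U_apart[OF C(2,1)[OF D(1)[OF that]] I_carrier[OF True] C(3)[OF D(1)[OF that] True]] by blast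
        then have "(K <#> snd p) \<inter> (K <#> W) \<noteq> {}" using meets unfolding KW1 by blast
        then have "(K' <#> snd p) \<inter> (K' <#> W) \<noteq> {}" using K_sub_K'[of "snd p"] K_sub_K'[of W] by blast
        then have "K' <#> snd p \<subseteq> W" using clean True unfolding clean_def by blast
        then show ?thesis using K_sub_K'[of "snd p"] unfolding W1_def by blast
      next
        case False
        then obtain c j where c: "(c, j) \<in> C" "p = piece (c, j)" using p by auto
        have sub: "K <#> (P j #> c) \<subseteq> U #> c" by (rule K_P_coset[OF C(2,1)[OF c(1)]])
        have "(c, j) \<in> D"
        proof (rule ccontr)
          assume no: "(c, j) \<notin> D"
          have "(U #> c) \<inter> (K <#> W) = {}" using no c(1) unfolding D_def by blast
          moreover have "(U #> c) \<inter> (K <#> (K <#> (P j' #> c'))) = {}" if "(c', j') \<in> D" for c' j'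
            using no that by (intro C_apart[OF c(1) D(1)]) auto
          ultimately have "(U #> c) \<inter> (K <#> W1) = {}" unfolding KW1 by blast
          then show False using meets sub c(2) by (auto simp: piece_def)
        qed
        then show ?thesis unfolding W1_def c(2) piece_def by auto
      qed
    qed
    obtain R where R: "W1 \<subseteq> R" "R \<subseteq> K <#> W1" "cut x R"
      using ext[rule_format, OF W1_fin W1_carrier clean1] by blast
    have W_R: "W \<subseteq> R" using R(1) unfolding W1_def by blast
    have R_K': "R \<subseteq> K' <#> W"
    proof -
      have car: "m_inv G ` U \<subseteq> carrier G" by (rule inv_image_carrier[OF U_carrier])
      note cl = K_carrier car W(2) PP_carrier KW set_mult_closed
      have "K <#> (K <#> ?Q) = (K <#> (K <#> ((\<Union>j\<in>J. P j) <#> (m_inv G ` U <#> K)))) <#> W"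
        by (simp only: set_mult_assoc cl)
      also have "\<dots> \<subseteq> K' <#> W" by (rule mono_set_mult) (auto simp: K'_def)
      finally have big: "K <#> (K <#> ?Q) \<subseteq> K' <#> W" .
      have "K <#> (K <#> (P j #> c)) \<subseteq> K' <#> W" if "(c, j) \<in> D" for c j
        by (rule order.trans[OF _ big]) (intro mono_set_mult order_refl coset_Q[OF that])
      then show ?thesis using R(2) K_sub_K'[of W] unfolding KW1 by blast
    qed
    have placed_D: "placed x R j c" if "(c, j) \<in> D" for c j
      unfolding placed_def
    proof (intro ballI conjI)
      fix w assume w: "w \<in> P j"
      show "x (w \<otimes> c) = y j w" by (rule x_piece[OF D(1)[OF that] w])
      have "w \<otimes> c \<in> P j #> c" using w unfolding r_coset_def by blast
      then have "w \<otimes> c \<in> K <#> (P j #> c)"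
        using subset_K_mult[OF coset_carrier[OF D(1)[OF that]]] by blast
      then show "w \<otimes> c \<in> R" using R(1) that unfolding W1_def by blast
    qed
    have outside_D: "(U #> c) \<inter> R = {}" if c: "(c, j) \<in> C" "(c, j) \<notin> D" for c j
    proof -
      have "(U #> c) \<inter> (K <#> W) = {}" using c unfolding D_def by blast
      moreover have "(U #> c) \<inter> (K <#> (K <#> (P j' #> c'))) = {}" if "(c', j') \<in> D" for c' j'
        using c(2) that by (intro C_apart[OF c(1) D(1)]) auto
      ultimately show ?thesis using R(2) unfolding KW1 by blast
    qed
    have "hit x R h \<or> N \<le> card {f\<in>F. avail x R f h}" if h: "h \<in> carrier G" for h
    proof (cases "\<exists>p\<in>\<I>. touch h p")
      case False
      have "\<exists>f\<in>part i. avail x R f h" if i: "i < N" for i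
      proof -
        have "part i \<in> \<S> h" using False i by (auto simp: \<S>_def)
        then obtain f where f: "f \<in> part i" "\<forall>j\<in>J. (\<sigma> j f \<otimes> h, j) \<in> C \<or>
            (\<exists>p\<in>\<I>. (U #> (\<sigma> j f \<otimes> h)) \<inter> snd p \<noteq> {})"
          using C_free[OF h] by blast
        have fF: "f \<in> F" using f(1) part[OF i] by blast
        have "(\<sigma> j f \<otimes> h, j) \<in> C" if j: "j \<in> J" for j
          using f(2) j False U_coset_T[OF fF j h] unfolding touch_def by blast
        then have "avail x R f h" unfolding avail_def using placed_D outside_D by blast
        then show ?thesis using f(1) by blast
      qed
      then obtain e where e: "\<And>i. i < N \<Longrightarrow> e i \<in> part i \<and> avail x R (e i) h" by metis
      have "inj_on e {..<N}"
      proof (rule inj_onI, rule ccontr)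
        fix i j assume "i \<in> {..<N}" "j \<in> {..<N}" "e i = e j" "i \<noteq> j"
        then show False using e[of i] e[of j] part_disjoint[of i j] by auto
      qed
      moreover have "e ` {..<N} \<subseteq> {f\<in>F. avail x R f h}" using e part by blast
      ultimately have "card {..<N} \<le> card {f\<in>F. avail x R f h}"
        using F_fin by (intro card_inj_on_le[of e]) auto
      then show ?thesis by simp
    next
      case True
      then obtain p where p: "p \<in> \<I>" "touch h p" by blast
      have T_p: "T #> h \<subseteq> K' <#> snd p"
        using T_coset_K'[OF h I_carrier[OF p(1)]] p(2) unfolding touch_def by blast
      consider "K' <#> snd p \<subseteq> W" | "(K' <#> snd p) \<inter> (K' <#> W) = {}"
        using clean p(1) unfolding clean_def by blast
      then show ?thesis
      proof cases
        case 1
        have p_R: "snd p \<subseteq> R" using 1 W_R sub_K'[OF I_carrier[OF p(1)]] by blast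
        have placed_p: "placed x R j s" if "placed (fst p) (snd p) j s" for j s
          using that p_R x p(1) unfolding placed_def by auto
        show ?thesis
        proof (cases "hit (fst p) (snd p) h")
          case True
          then show ?thesis using placed_p unfolding hit_def by blast
        next
          case no: False
          have "\<not> (\<exists>p'\<in>\<I>. touch h p' \<and> hit (fst p') (snd p') h)"
            using no touch_unique[OF h p(1) _ p(2)] by metis
          then have "\<Phi> h \<in> \<S> h" using \<open>\<exists>p\<in>\<I>. touch h p\<close> unfolding \<S>_def by simp
          then obtain f where f: "f \<in> \<Phi> h" "\<forall>j\<in>J. (\<sigma> j f \<otimes> h, j) \<in> C \<or>
              (\<exists>p\<in>\<I>. (U #> (\<sigma> j f \<otimes> h)) \<inter> snd p \<noteq> {})"
            using C_free[OF h] by blast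
          have fF: "f \<in> F" and av: "avail (fst p) (snd p) f h" using f(1) \<Phi>_eq[OF h p] by auto
          have "placed x R j (\<sigma> j f \<otimes> h)" if j: "j \<in> J" for j
          proof (cases "placed (fst p) (snd p) j (\<sigma> j f \<otimes> h)")
            case True
            then show ?thesis by (rule placed_p)
          next
            case False
            then have free: "(U #> (\<sigma> j f \<otimes> h)) \<inter> snd p = {}" using av j unfolding avail_def by blast
            have sub: "U #> (\<sigma> j f \<otimes> h) \<subseteq> T #> h" by (rule U_coset_T[OF fF j h])
            have "(U #> (\<sigma> j f \<otimes> h)) \<inter> snd p' = {}" if p': "p' \<in> \<I>" for p'
            proof (cases "touch h p'")
              case True
              then show ?thesis using touch_unique[OF h p(1) p' p(2)] free by simp
            qed (use sub in \<open>auto simp: touch_def\<close>)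
            then have inC: "(\<sigma> j f \<otimes> h, j) \<in> C" using f(2) j by blast
            have "\<sigma> j f \<otimes> h \<in> W"
              using self_U_coset[OF \<sigma>_mult_carrier[OF j fF h]] sub T_p 1 by blast
            then have "\<sigma> j f \<otimes> h \<in> K <#> W" using subset_K_mult[OF W(2)] by blast
            then have "(\<sigma> j f \<otimes> h, j) \<in> D"
              using inC self_U_coset[OF \<sigma>_mult_carrier[OF j fF h]] unfolding D_def by blast
            then show ?thesis by (rule placed_D)
          qed
          then show ?thesis using fF unfolding hit_def by blast
        qed
      next
        case 2
        then have "(T #> h) \<inter> R = {}" using T_p R_K' by blast
        then have "{f\<in>F. avail x R f h} = F" using avail_untouched[OF _ h] by blast
        then show ?thesis using card_F N_pos by simp
      qed
    qed
    then have "cut' x R" using R(3) unfolding cut'_def by blast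
    then show ?thesis using W_R R_K' by blast
  qed
  moreover have "\<forall>p\<in>\<I>. \<forall>r\<in>snd p. x r = fst p r" using x by (simp add: ball_Un)
  ultimately show ?thesis by (intro exI[of _ x]) simp
qed

lemma pliable_cut': "pliable G cut' K'"
proof
  show "finite K'" "K' \<subseteq> carrier G" "\<one> \<in> K'" by (fact K'_fin K'_carrier one_K')+
  show "finite R" "R \<subseteq> carrier G" if "cut' x R" for x R
    using that cut_fin cut_carrier unfolding cut'_def by blast+
qed (erule (1) cut'_shift, erule (2) cut'_small, erule (1) cut'_glue)

text \<open>Once \<open>R\<close> contains all zones relevant for \<open>h\<close>, an element of \<open>F\<close> is usable only if its copies
  are in place.\<close>
lemma hit_points:
  assumes x: "x \<in> pliable.points G cut'" and h: "h \<in> carrier G"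
  shows "\<exists>f\<in>F. \<forall>j\<in>J. \<forall>w\<in>P j. x (w \<otimes> (\<sigma> j f \<otimes> h)) = y j w"
proof -
  interpret new: pliable G cut' K' by (rule pliable_cut')
  have "finite (T #> h)" "T #> h \<subseteq> carrier G"
    using T_fin T_carrier h by (auto intro: finite_r_coset dest: r_coset_subset_G[THEN subsetD])
  then obtain R where R: "T #> h \<subseteq> R" "cut' x R" using x unfolding new.points_def by blast
  have "hit x R h"
  proof (rule ccontr)
    assume no: "\<not> hit x R h"
    then have "N \<le> card {f\<in>F. avail x R f h}" using R(2) h unfolding cut'_def by blast
    then have "{f\<in>F. avail x R f h} \<noteq> {}" using N_pos by (metis card.empty not_le)
    then obtain f where f: "f \<in> F" "avail x R f h" by blast
    have "placed x R j (\<sigma> j f \<otimes> h)" if j: "j \<in> J" for j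
      using f(2) j self_U_coset[OF \<sigma>_mult_carrier[OF j f(1) h]] U_coset_T[OF f(1) j h] R(1)
      unfolding avail_def by blast
    then show False using no f(1) unfolding hit_def by blast
  qed
  then show ?thesis unfolding hit_def placed_def by blast
qed

end

section \<open>Meeting a single requirement\<close>

lemma ex_conflict_free_subset:
  assumes sym: "\<And>f f'. conf f f' \<Longrightarrow> conf f' f"
    and deg: "\<And>f. f \<in> A \<Longrightarrow> card {f'\<in>A. conf f f'} \<le> D"
    and "finite A" "n * Suc D \<le> card A"
  shows "\<exists>F\<subseteq>A. card F = n \<and> (\<forall>f\<in>F. \<forall>f'\<in>F. f \<noteq> f' \<longrightarrow> \<not> conf f f')"
  using assms(2-)
proof (induction n arbitrary: A)
  case 0
  show ?case by (intro exI[of _ "{}"]) auto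
next
  case (Suc n)
  then have "A \<noteq> {}" by auto
  then obtain a where a: "a \<in> A" by blast
  let ?X = "insert a {f'\<in>A. conf a f'}"
  let ?A = "A - ?X"
  have "card ?X \<le> Suc (card {f'\<in>A. conf a f'})" using Suc.prems(2) by (simp add: card_insert_if)
  then have X: "card ?X \<le> Suc D" using Suc.prems(1)[OF a] by simp
  have "card ?A = card A - card ?X" using Suc.prems(2) a by (intro card_Diff_subset) auto
  then have big: "n * Suc D \<le> card ?A" using X Suc.prems(3) by simp
  have "card {f'\<in>?A. conf f f'} \<le> D" if "f \<in> ?A" for f
  proof -
    have "card {f'\<in>?A. conf f f'} \<le> card {f'\<in>A. conf f f'}"
      using Suc.prems(2) by (intro card_mono) auto
    then show ?thesis using Suc.prems(1)[of f] that by simp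
  qed
  then obtain F where F: "F \<subseteq> ?A" "card F = n" "\<forall>f\<in>F. \<forall>f'\<in>F. f \<noteq> f' \<longrightarrow> \<not> conf f f'"
    using Suc.IH[of ?A] Suc.prems(2) big by blast
  have "finite F" using F(1) Suc.prems(2) finite_subset by blast
  moreover have "a \<notin> F" using F(1) by blast
  ultimately have "card (insert a F) = Suc n" using F(2) by simp
  moreover have "\<not> conf f f'" if "f \<in> insert a F" "f' \<in> insert a F" "f \<noteq> f'" for f f'
    using that F sym[of f f'] by blast
  ultimately show ?case using F(1) a by (intro exI[of _ "insert a F"]) auto
qed

context pliable
begin

lemma points_shift:
  assumes x: "x \<in> points" and g: "g \<in> carrier G"
  shows "shift g x \<in> points"
  unfolding points_def
proof (intro CollectI allI impI)
  fix W assume W: "finite W" "W \<subseteq> carrier G"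
  have "finite (W #> g)" "W #> g \<subseteq> carrier G"
    using W g by (auto intro: finite_r_coset dest: r_coset_subset_G[THEN subsetD])
  then obtain R where R: "W #> g \<subseteq> R" "cut x R" using x unfolding points_def by blast
  have "W \<subseteq> R #> inv g"
  proof
    fix w assume w: "w \<in> W"
    then have "w = (w \<otimes> g) \<otimes> inv g" using W(2) g by (auto simp: m_assoc)
    moreover have "w \<otimes> g \<in> R" using w R(1) by (auto simp: r_coset_def)
    ultimately show "w \<in> R #> inv g" unfolding r_coset_def by blast
  qed
  then show "\<exists>R. W \<subseteq> R \<and> cut (shift g x) R" using cut_shift[OF R(2) g] by blast
qed

lemma points_nonempty: "points \<noteq> {}"
  using glue_point[of "{}"] by (auto simp: separated_def)

text \<open>
  How large the set \<open>F\<close> must be depends on the templates and on \<open>K\<close> only. This is what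
  makes arbitrary unbounded families usable: a sufficiently large member can be thinned out to a set whose
  \<open>B\<close>-zones are disjoint, and hitting the thinner set is even more than required. The set
  \<open>B\<close> is exposed because with several templates the places belonging to one \<open>f\<close> must
  not be \<open>B\<close>-close to each other.
\<close>
theorem ex_refinement:
  fixes J :: "nat set"
  assumes J: "finite J" "J \<noteq> {}" and template: "\<And>j. j \<in> J \<Longrightarrow> cut (y j) (P j)"
  obtains B n where "finite B" "B \<subseteq> carrier G"
    "\<And>F \<sigma>. finite F \<Longrightarrow> F \<subseteq> carrier G \<Longrightarrow> n \<le> card F \<Longrightarrow>
      (\<And>j. j \<in> J \<Longrightarrow> \<sigma> j ` F \<subseteq> carrier G \<and> inj_on (\<sigma> j) F) \<Longrightarrow>
      (\<And>f i j. f \<in> F \<Longrightarrow> i \<in> J \<Longrightarrow> j \<in> J \<Longrightarrow> i \<noteq> j \<Longrightarrow> \<sigma> j f \<notin> B #> \<sigma> i f) \<Longrightarrow>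
      \<exists>cut' K'. pliable G cut' K' \<and> (\<forall>x R. cut' x R \<longrightarrow> cut x R) \<and>
        (\<forall>x\<in>pliable.points G cut'. \<forall>h\<in>carrier G. \<exists>f\<in>F. \<forall>j\<in>J. \<forall>w\<in>P j.
          x (w \<otimes> (\<sigma> j f \<otimes> h)) = y j w)"
proof -
  let ?P = "\<Union>j\<in>J. P j"
  let ?K = "m_inv G ` K"
  define U where "U = insert \<one> ((K <#> ?P) \<union> (?K <#> (K <#> (K <#> ?P))) \<union> (?K <#> (?K <#> (K <#> ?P))))"
  define B where "B = insert \<one> (m_inv G ` (K <#> (K <#> ?P)) <#> U)"
  have P_fin: "finite ?P" and P_carrier: "?P \<subseteq> carrier G"
    using J template cut_fin cut_carrier by blast+
  have Pj: "P j \<subseteq> carrier G" if "j \<in> J" for j using P_carrier that by blast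
  have iK: "?K \<subseteq> carrier G" using K_carrier by auto
  have U_fin: "finite U" unfolding U_def using P_fin K_fin by (auto intro!: finite_set_mult)
  have U_carrier: "U \<subseteq> carrier G"
    unfolding U_def using K_carrier iK P_carrier by (intro insert_subsetI Un_least set_mult_closed) auto
  have B_fin: "finite B" unfolding B_def using P_fin K_fin U_fin by (auto intro!: finite_set_mult)
  have "m_inv G ` (K <#> (K <#> ?P)) \<subseteq> carrier G"
    using K_mult_carrier[OF K_mult_carrier[OF P_carrier]] by auto
  then have B_carrier: "B \<subseteq> carrier G"
    unfolding B_def using U_carrier by (intro insert_subsetI set_mult_closed) auto
  have U_apart: "(K <#> (K <#> (P j #> c))) \<inter> (K <#> R) = {} \<and> (K <#> (K <#> R)) \<inter> (K <#> (P j #> c)) = {}"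
    if j: "j \<in> J" and c: "c \<in> carrier G" and R: "R \<subseteq> carrier G" and dis: "(U #> c) \<inter> R = {}" for j c R
  proof (intro conjI; rule ccontr)
    assume "(K <#> (K <#> (P j #> c))) \<inter> (K <#> R) \<noteq> {}"
    then obtain k1 k2 k3 p r where k: "k1 \<in> K" "k2 \<in> K" "k3 \<in> K" "p \<in> P j" "r \<in> R"
      "k3 \<otimes> r = k1 \<otimes> (k2 \<otimes> (p \<otimes> c))" by (auto simp: set_mult_def r_coset_def)
    have car: "k1 \<in> carrier G" "k2 \<in> carrier G" "k3 \<in> carrier G" "p \<in> carrier G" "r \<in> carrier G"
      using k K_carrier Pj[OF j] R by auto
    have "r = inv k3 \<otimes> (k3 \<otimes> r)" using car by (simp flip: m_assoc)
    also have "\<dots> = (inv k3 \<otimes> (k1 \<otimes> (k2 \<otimes> p))) \<otimes> c"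
      unfolding k(6) using car c by (simp add: m_assoc)
    finally have r: "r = (inv k3 \<otimes> (k1 \<otimes> (k2 \<otimes> p))) \<otimes> c" .
    have "inv k3 \<otimes> (k1 \<otimes> (k2 \<otimes> p)) \<in> ?K <#> (K <#> (K <#> ?P))"
      using k j by (intro in_set_mult imageI) auto
    then have "r \<in> U #> c" unfolding r by (intro in_r_coset) (auto simp: U_def)
    then show False using dis k(5) by blast
  next
    assume "(K <#> (K <#> R)) \<inter> (K <#> (P j #> c)) \<noteq> {}"
    then obtain k1 k2 k3 p r where k: "k1 \<in> K" "k2 \<in> K" "k3 \<in> K" "p \<in> P j" "r \<in> R"
      "k3 \<otimes> (p \<otimes> c) = k1 \<otimes> (k2 \<otimes> r)" by (auto simp: set_mult_def r_coset_def)
    have car: "k1 \<in> carrier G" "k2 \<in> carrier G" "k3 \<in> carrier G" "p \<in> carrier G" "r \<in> carrier G"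
      using k K_carrier Pj[OF j] R by auto
    have "r = inv k2 \<otimes> (inv k1 \<otimes> (k1 \<otimes> (k2 \<otimes> r)))" using car by (simp flip: m_assoc)
    also have "\<dots> = (inv k2 \<otimes> (inv k1 \<otimes> (k3 \<otimes> p))) \<otimes> c"
      using car c by (simp add: m_assoc flip: k(6))
    finally have r: "r = (inv k2 \<otimes> (inv k1 \<otimes> (k3 \<otimes> p))) \<otimes> c" .
    have "inv k2 \<otimes> (inv k1 \<otimes> (k3 \<otimes> p)) \<in> ?K <#> (?K <#> (K <#> ?P))"
      using k j by (intro in_set_mult imageI) auto
    then have "r \<in> U #> c" unfolding r by (intro in_r_coset) (auto simp: U_def)
    then show False using dis k(5) by blast
  qed
  have B_apart: "(U #> c) \<inter> (K <#> (K <#> (P j #> c'))) = {}"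
    if j: "j \<in> J" and c: "c \<in> carrier G" "c' \<in> carrier G" and notin: "c' \<notin> B #> c" for j c c'
  proof (rule ccontr)
    assume "(U #> c) \<inter> (K <#> (K <#> (P j #> c'))) \<noteq> {}"
    then obtain u k1 k2 p where k: "u \<in> U" "k1 \<in> K" "k2 \<in> K" "p \<in> P j"
      "u \<otimes> c = k1 \<otimes> (k2 \<otimes> (p \<otimes> c'))" by (auto simp: set_mult_def r_coset_def)
    have car: "u \<in> carrier G" "k1 \<in> carrier G" "k2 \<in> carrier G" "p \<in> carrier G"
      using k K_carrier U_carrier Pj[OF j] by auto
    let ?q = "k1 \<otimes> (k2 \<otimes> p)"
    have q: "?q \<in> carrier G" using car by simp
    have qK: "?q \<in> K <#> (K <#> ?P)" using k j by (intro in_set_mult) auto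
    have "c' = inv ?q \<otimes> (?q \<otimes> c')" using q c by (simp flip: m_assoc)
    also have "?q \<otimes> c' = u \<otimes> c" using car c by (simp add: m_assoc k(5))
    also have "inv ?q \<otimes> (u \<otimes> c) = (inv ?q \<otimes> u) \<otimes> c" using q car c by (simp only: m_assoc inv_closed)
    finally have "c' = (inv ?q \<otimes> u) \<otimes> c" .
    moreover have "inv ?q \<otimes> u \<in> B" unfolding B_def by (rule insertI2[OF in_set_mult[OF imageI[OF qK] k(1)]])
    ultimately show False using notin in_r_coset by metis
  qed
  have "card J \<noteq> 0" using J by simp
  moreover have "card B \<noteq> 0" using B_fin by (auto simp: B_def)
  ultimately have k_pos: "1 \<le> card J * card B" by simp
  obtain \<beta> \<rho> :: real and N where par: "0 < \<beta>" "0 \<le> \<rho>" "\<rho> \<le> 1" "2 * card J * card U + 1 \<le> N" "0 < N"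
    "\<And>s. s \<le> card J * card B \<Longrightarrow> real (Suc (card J) ^ s) - 1 \<le> \<rho> * \<beta> ^ s"
    "\<beta> + real (card J * card B * N ^ 3) * \<beta> * \<rho> ^ N \<le> real (Suc (card J))"
    by (rule ex_block_parameters[of "Suc (card J)" "card J * card B" "2 * card J * card U + 1"
          "card J * card B"]) (use k_pos in auto)
  have "(2 * card J * card U + 1) * N \<le> N * N" using par(4) by (rule mult_le_mono1)
  moreover have "2 * card J * card U \<le> 2 * card J * card U * N" using par(5) by simp
  ultimately have N_large: "N + 2 * card J * card U \<le> N * N"
    unfolding add_mult_distrib by linarith
  let ?D = "card J * (card B * (card J * card B))"
  show ?thesis
  proof (rule that[OF B_fin B_carrier, of "N * N * Suc ?D"])
    fix F0 \<sigma>
    assume F0: "finite F0" "F0 \<subseteq> carrier G" "N * N * Suc ?D \<le> card F0"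
      and \<sigma>: "\<And>j. j \<in> J \<Longrightarrow> \<sigma> j ` F0 \<subseteq> carrier G \<and> inj_on (\<sigma> j) F0"
      and consistent: "\<And>f i j. f \<in> F0 \<Longrightarrow> i \<in> J \<Longrightarrow> j \<in> J \<Longrightarrow> i \<noteq> j \<Longrightarrow> \<sigma> j f \<notin> B #> \<sigma> i f"
    define Z where "Z f = (\<Union>i\<in>J. B #> \<sigma> i f)" for f
    define conf where "conf f f' \<longleftrightarrow> Z f \<inter> Z f' \<noteq> {}" for f f'
    have \<sigma>_carrier: "\<sigma> j f \<in> carrier G" if "j \<in> J" "f \<in> F0" for j f using \<sigma> that by blast
    have "card {f'\<in>F0. conf f f'} \<le> ?D" if f: "f \<in> F0" for f
    proof -
      let ?X = "m_inv G ` B <#> Z f"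
      have Z_fin: "finite (Z f)" unfolding Z_def using J B_fin by (auto intro: finite_r_coset)
      have "card (Z f) \<le> (\<Sum>i\<in>J. card (B #> \<sigma> i f))" unfolding Z_def by (rule card_UN_le[OF J(1)])
      also have "\<dots> \<le> (\<Sum>i\<in>J. card B)"
      proof (rule sum_mono)
        fix i
        have "B #> \<sigma> i f = (\<lambda>b. b \<otimes> \<sigma> i f) ` B" by (auto simp: r_coset_def)
        then show "card (B #> \<sigma> i f) \<le> card B" using card_image_le[OF B_fin] by metis
      qed
      finally have card_Z: "card (Z f) \<le> card J * card B" by simp
      have X_fin: "finite ?X" using B_fin Z_fin by (intro finite_set_mult) auto
      have "?X = (\<lambda>(b, z). inv b \<otimes> z) ` (B \<times> Z f)" by (auto simp: set_mult_def)
      then have "card ?X \<le> card (B \<times> Z f)" using B_fin Z_fin by (metis card_image_le finite_cartesian_product)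
      also have "\<dots> \<le> card B * (card J * card B)" using card_Z by (simp add: card_cartesian_product)
      finally have card_X: "card ?X \<le> card B * (card J * card B)" .
      have fib: "card {f'\<in>F0. \<sigma> j f' \<in> ?X} \<le> card B * (card J * card B)" if j: "j \<in> J" for j
      proof -
        have "inj_on (\<sigma> j) {f'\<in>F0. \<sigma> j f' \<in> ?X}" using \<sigma>[OF j] by (auto intro: inj_on_subset)
        then have "card {f'\<in>F0. \<sigma> j f' \<in> ?X} \<le> card ?X"
          by (rule card_inj_on_le) (auto simp: X_fin)
        then show ?thesis using card_X by simp
      qed
      have "{f'\<in>F0. conf f f'} \<subseteq> (\<Union>j\<in>J. {f'\<in>F0. \<sigma> j f' \<in> ?X})"
      proof
        fix f' assume "f' \<in> {f'\<in>F0. conf f f'}"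
        then have "f' \<in> F0" "Z f \<inter> (\<Union>j\<in>J. B #> \<sigma> j f') \<noteq> {}"
          by (simp_all add: conf_def flip: Z_def)
        then obtain j where j: "j \<in> J" "f' \<in> F0" "(B #> \<sigma> j f') \<inter> Z f \<noteq> {}"
          by blast
        then obtain b where b: "b \<in> B" "b \<otimes> \<sigma> j f' \<in> Z f" by (auto simp: r_coset_def)
        have "\<sigma> j f' = inv b \<otimes> (b \<otimes> \<sigma> j f')"
          using b(1) B_carrier \<sigma>_carrier[OF j(1,2)] by (simp add: subset_iff flip: m_assoc)
        then have "\<sigma> j f' \<in> ?X" using b unfolding set_mult_def by blast
        then show "f' \<in> (\<Union>j\<in>J. {f'\<in>F0. \<sigma> j f' \<in> ?X})" using j by blast
      qed
      then have "card {f'\<in>F0. conf f f'} \<le> card (\<Union>j\<in>J. {f'\<in>F0. \<sigma> j f' \<in> ?X})"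
        using J F0 by (intro card_mono) auto
      also have "\<dots> \<le> (\<Sum>j\<in>J. card {f'\<in>F0. \<sigma> j f' \<in> ?X})" by (rule card_UN_le[OF J(1)])
      also have "\<dots> \<le> (\<Sum>j\<in>J. card B * (card J * card B))" using fib by (rule sum_mono)
      finally show ?thesis by simp
    qed
    moreover have "conf f' f" if "conf f f'" for f f' using that unfolding conf_def by blast
    ultimately obtain F where F: "F \<subseteq> F0" "card F = N * N"
      "\<forall>f\<in>F. \<forall>f'\<in>F. f \<noteq> f' \<longrightarrow> \<not> conf f f'"
      using ex_conflict_free_subset[of conf F0 ?D "N * N"] F0 by blast
    interpret refinement G cut K J y P U B F \<sigma> N \<beta> \<rho>
    proof
      show "finite F" using F(1) F0 finite_subset by blast
      show "K <#> P j \<subseteq> U" if "j \<in> J" for j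
        using mono_set_mult[of K K "P j" ?P] that unfolding U_def by blast
      show "(B #> \<sigma> i f) \<inter> (B #> \<sigma> j f') = {}"
        if "f \<in> F" "f' \<in> F" "f \<noteq> f'" "i \<in> J" "j \<in> J" for f f' i j
        using F(3) that unfolding conf_def Z_def by blast
      show "\<sigma> j f \<in> carrier G" if "j \<in> J" "f \<in> F" for j f using \<sigma>_carrier that F(1) by blast
      show "\<sigma> j f \<notin> B #> \<sigma> i f" if "f \<in> F" "i \<in> J" "j \<in> J" "i \<noteq> j" for f i j
        using consistent that F(1) by blast
      show "\<one> \<in> U" "\<one> \<in> B" by (simp_all add: U_def B_def)
    qed (fact J(1) template U_fin U_carrier B_fin B_carrier U_apart B_apart F(2) par N_large)+
    have "\<exists>f\<in>F0. \<forall>j\<in>J. \<forall>w\<in>P j. x (w \<otimes> (\<sigma> j f \<otimes> h)) = y j w"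
      if "x \<in> pliable.points G cut'" "h \<in> carrier G" for x h
      using hit_points[OF that] F(1) by blast
    moreover have "\<forall>x R. cut' x R \<longrightarrow> cut x R" unfolding cut'_def by blast
    ultimately show "\<exists>cut' K'. pliable G cut' K' \<and> (\<forall>x R. cut' x R \<longrightarrow> cut x R) \<and>
        (\<forall>x\<in>pliable.points G cut'. \<forall>h\<in>carrier G. \<exists>f\<in>F0. \<forall>j\<in>J. \<forall>w\<in>P j.
          x (w \<otimes> (\<sigma> j f \<otimes> h)) = y j w)"
      using pliable_cut' by blast
  qed
qed

lemma ex_refinement_syndetic:
  assumes x: "x \<in> points" and W: "finite W" "W \<subseteq> carrier G"
    and \<F>: "\<And>F. F \<in> \<F> \<Longrightarrow> finite F \<and> F \<subseteq> carrier G" "unbounded_family \<F>"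
  shows "\<exists>cut' K'. pliable G cut' K' \<and> (\<forall>x R. cut' x R \<longrightarrow> cut x R) \<and>
    (\<exists>F\<in>\<F>. \<forall>z\<in>pliable.points G cut'. \<forall>h\<in>carrier G. \<exists>f\<in>F. \<forall>w\<in>W. z (w \<otimes> (f \<otimes> h)) = x w)"
proof -
  obtain R where R: "W \<subseteq> R" "cut x R" using x W unfolding points_def by blast
  obtain B n where Bn: "\<And>F (\<sigma> :: nat \<Rightarrow> _). finite F \<Longrightarrow> F \<subseteq> carrier G \<Longrightarrow> n \<le> card F \<Longrightarrow>
      (\<And>j. j \<in> {0::nat} \<Longrightarrow> \<sigma> j ` F \<subseteq> carrier G \<and> inj_on (\<sigma> j) F) \<Longrightarrow>
      (\<And>f i j. f \<in> F \<Longrightarrow> i \<in> {0::nat} \<Longrightarrow> j \<in> {0} \<Longrightarrow> i \<noteq> j \<Longrightarrow> \<sigma> j f \<notin> B #> \<sigma> i f) \<Longrightarrow>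
      \<exists>cut' K'. pliable G cut' K' \<and> (\<forall>x R. cut' x R \<longrightarrow> cut x R) \<and>
        (\<forall>z\<in>pliable.points G cut'. \<forall>h\<in>carrier G. \<exists>f\<in>F. \<forall>j\<in>{0}. \<forall>w\<in>R.
          z (w \<otimes> (\<sigma> j f \<otimes> h)) = x w)"
    by (rule ex_refinement[of "{0}" "\<lambda>_. x" "\<lambda>_. R"]) (use R in auto)
  have "\<exists>F\<in>\<F>. n \<le> card F"
  proof (rule ccontr)
    assume "\<not> (\<exists>F\<in>\<F>. n \<le> card F)"
    then have "(SUP F\<in>\<F>. enat (card F)) \<le> enat n" by (intro SUP_least) auto
    then show False using \<F>(2) unfolding unbounded_family_def by simp
  qed
  then obtain F where F: "F \<in> \<F>" "n \<le> card F" by blast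
  have "\<exists>cut' K'. pliable G cut' K' \<and> (\<forall>x R. cut' x R \<longrightarrow> cut x R) \<and>
        (\<forall>z\<in>pliable.points G cut'. \<forall>h\<in>carrier G. \<exists>f\<in>F. \<forall>j\<in>{0::nat}. \<forall>w\<in>R.
          z (w \<otimes> ((\<lambda>_ f. f) j f \<otimes> h)) = x w)"
    using \<F>(1)[OF F(1)] F(2) by (intro Bn) auto
  then obtain cut' K' where c: "pliable G cut' K'" "\<forall>x R. cut' x R \<longrightarrow> cut x R"
    and hit: "\<forall>z\<in>pliable.points G cut'. \<forall>h\<in>carrier G. \<exists>f\<in>F. \<forall>w\<in>R. z (w \<otimes> (f \<otimes> h)) = x w"
    by auto
  have "\<exists>f\<in>F. \<forall>w\<in>W. z (w \<otimes> (f \<otimes> h)) = x w"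
    if "z \<in> pliable.points G cut'" "h \<in> carrier G" for z h
    using hit[rule_format, OF that] R(1) by blast
  then have "\<exists>F\<in>\<F>. \<forall>z\<in>pliable.points G cut'. \<forall>h\<in>carrier G. \<exists>f\<in>F. \<forall>w\<in>W. z (w \<otimes> (f \<otimes> h)) = x w"
    by (intro bexI[OF _ F(1)]) simp
  with c show ?thesis by (intro exI conjI)
qed

text \<open>
  The points \<open>t \<otimes> \<gamma> \<otimes> h\<close> and \<open>t \<otimes> h\<close> differ by the
  conjugate \<open>\<kappa> = t \<otimes> \<gamma> \<otimes> inv t\<close> on the left. If infinitely many
  \<open>t\<close> give conjugates outside a certain finite set, the two points are far apart and can carry two
  independent templates, one for each symbol. Otherwise one and the same conjugate
  \<open>\<kappa> \<noteq> \<one>\<close> arises from infinitely many \<open>t\<close>, and a single template on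
  \<open>{\<one>, \<kappa>}\<close> with different values at its two places serves all of them.
\<close>
lemma ex_refinement_free:
  assumes inf: "infinite (carrier G)" and \<gamma>: "\<gamma> \<in> carrier G" "\<gamma> \<noteq> \<one>"
  shows "\<exists>cut' K'. pliable G cut' K' \<and> (\<forall>x R. cut' x R \<longrightarrow> cut x R) \<and>
    (\<exists>T. finite T \<and> T \<subseteq> carrier G \<and>
      (\<forall>z\<in>pliable.points G cut'. \<forall>h\<in>carrier G. \<exists>t\<in>T. z (t \<otimes> (\<gamma> \<otimes> h)) \<noteq> z (t \<otimes> h)))"
proof -
  let ?J = "{0, 1::nat}"
  obtain B n where B: "finite B" "B \<subseteq> carrier G"
    and Bn: "\<And>F \<sigma>. finite F \<Longrightarrow> F \<subseteq> carrier G \<Longrightarrow> n \<le> card F \<Longrightarrow>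
      (\<And>j. j \<in> ?J \<Longrightarrow> \<sigma> j ` F \<subseteq> carrier G \<and> inj_on (\<sigma> j) F) \<Longrightarrow>
      (\<And>f i j. f \<in> F \<Longrightarrow> i \<in> ?J \<Longrightarrow> j \<in> ?J \<Longrightarrow> i \<noteq> j \<Longrightarrow> \<sigma> j f \<notin> B #> \<sigma> i f) \<Longrightarrow>
      \<exists>cut' K'. pliable G cut' K' \<and> (\<forall>x R. cut' x R \<longrightarrow> cut x R) \<and>
        (\<forall>z\<in>pliable.points G cut'. \<forall>h\<in>carrier G. \<exists>f\<in>F. \<forall>j\<in>?J. \<forall>w\<in>{\<one>}.
          z (w \<otimes> (\<sigma> j f \<otimes> h)) = (j = 0))"
    by (rule ex_refinement[of ?J "\<lambda>j _. j = 0" "\<lambda>_. {\<one>}"]) (auto intro: cut_small)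
  let ?c = "\<lambda>t. t \<otimes> \<gamma> \<otimes> inv t"
  let ?B = "B \<union> m_inv G ` B"
  show ?thesis
  proof (cases "infinite {t\<in>carrier G. ?c t \<notin> ?B}")
    case True
    obtain T where T: "finite T" "card T = n" "T \<subseteq> {t\<in>carrier G. ?c t \<notin> ?B}"
      using infinite_arbitrarily_large[OF True] by blast
    let ?\<sigma> = "\<lambda>j t. if j = (0::nat) then t else t \<otimes> \<gamma>"
    have one: "t \<otimes> \<gamma> \<notin> B #> t" and two: "t \<notin> B #> (t \<otimes> \<gamma>)" if t: "t \<in> T" for t
    proof -
      have tc: "t \<in> carrier G" "?c t \<notin> B" "?c t \<notin> m_inv G ` B" using t T(3) by auto
      show "t \<otimes> \<gamma> \<notin> B #> t"
      proof
        assume "t \<otimes> \<gamma> \<in> B #> t"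
        then obtain b where b: "b \<in> B" "t \<otimes> \<gamma> = b \<otimes> t" by (auto simp: r_coset_def)
        then have "?c t = b" using B(2) tc(1) by (auto simp: m_assoc)
        then show False using tc b by simp
      qed
      show "t \<notin> B #> (t \<otimes> \<gamma>)"
      proof
        assume "t \<in> B #> (t \<otimes> \<gamma>)"
        then obtain b where b: "b \<in> B" "t = b \<otimes> (t \<otimes> \<gamma>)" by (auto simp: r_coset_def)
        have bc: "b \<in> carrier G" using b(1) B(2) by blast
        have "inv b \<otimes> t = t \<otimes> \<gamma>"
          using b(2) bc tc(1) \<gamma>(1) by (metis inv_solve_left m_closed)
        then have "?c t = inv b" using bc tc(1) by (simp add: m_assoc flip: \<open>inv b \<otimes> t = t \<otimes> \<gamma>\<close>)
        then show False using tc b by simp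
      qed
    qed
    have T_carrier: "T \<subseteq> carrier G" using T(3) by blast
    have "\<exists>cut' K'. pliable G cut' K' \<and> (\<forall>x R. cut' x R \<longrightarrow> cut x R) \<and>
        (\<forall>z\<in>pliable.points G cut'. \<forall>h\<in>carrier G. \<exists>f\<in>T. \<forall>j\<in>?J. \<forall>w\<in>{\<one>}.
          z (w \<otimes> (?\<sigma> j f \<otimes> h)) = (j = 0))"
    proof (rule Bn)
      show "?\<sigma> j ` T \<subseteq> carrier G \<and> inj_on (?\<sigma> j) T" for j
        using T_carrier \<gamma>(1) by (auto simp: inj_on_def subset_iff)
    qed (use T T_carrier one two in auto)
    then obtain cut' K' where c: "pliable G cut' K'" "\<forall>x R. cut' x R \<longrightarrow> cut x R"
      and hit: "\<forall>z\<in>pliable.points G cut'. \<forall>h\<in>carrier G. \<exists>f\<in>T. \<forall>j\<in>?J. \<forall>w\<in>{\<one>}.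
          z (w \<otimes> (?\<sigma> j f \<otimes> h)) = (j = 0)" by blast
    have "\<exists>t\<in>T. z (t \<otimes> (\<gamma> \<otimes> h)) \<noteq> z (t \<otimes> h)"
      if z: "z \<in> pliable.points G cut'" and h: "h \<in> carrier G" for z h
    proof -
      obtain t where t: "t \<in> T" "\<forall>j\<in>?J. \<forall>w\<in>{\<one>}. z (w \<otimes> (?\<sigma> j t \<otimes> h)) = (j = 0)"
        using bspec[OF bspec[OF hit z] h] by (elim bexE)
      have "t \<in> carrier G" using t(1) T_carrier by blast
      then have "z (t \<otimes> h)" "\<not> z (t \<otimes> (\<gamma> \<otimes> h))" using t(2) h \<gamma>(1) by (auto simp: m_assoc)
      then show ?thesis using t(1) by blast
    qed
    then have "\<exists>T. finite T \<and> T \<subseteq> carrier G \<and>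
      (\<forall>z\<in>pliable.points G cut'. \<forall>h\<in>carrier G. \<exists>t\<in>T. z (t \<otimes> (\<gamma> \<otimes> h)) \<noteq> z (t \<otimes> h))"
      using T(1) T_carrier by (intro exI[of _ T]) simp
    note all = conjI[OF c(1) conjI[OF c(2) this]]
    show ?thesis by (rule exI[of _ cut'], rule exI[of _ K'], fact all)
  next
    case False
    let ?A = "{t\<in>carrier G. ?c t \<in> ?B}"
    have A: "infinite ?A"
    proof
      assume "finite ?A"
      then have "finite (?A \<union> {t\<in>carrier G. ?c t \<notin> ?B})" using False by simp
      then have "finite (carrier G)" by (rule rev_finite_subset) blast
      then show False using inf by simp
    qed
    have "finite (?c ` ?A)" by (rule finite_subset[of _ ?B]) (use B(1) in auto)
    then obtain t0 where t0: "t0 \<in> ?A" "infinite {t\<in>?A. ?c t = ?c t0}"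
      using pigeonhole_infinite[OF A] by blast
    define \<kappa> where "\<kappa> = ?c t0"
    have \<kappa>: "\<kappa> \<in> carrier G" using t0(1) \<gamma>(1) by (simp add: \<kappa>_def)
    have "\<kappa> \<noteq> \<one>"
    proof
      assume "\<kappa> = \<one>"
      then have "t0 \<otimes> \<gamma> = t0" using t0(1) \<gamma>(1) unfolding \<kappa>_def
        by (metis (lifting) inv_solve_right' l_one m_closed mem_Collect_eq one_closed)
      then show False using t0(1) \<gamma> by simp
    qed
    have conj: "\<kappa> \<otimes> t = t \<otimes> \<gamma>" if "t \<in> carrier G" "?c t = \<kappa>" for t
      using that(1) \<gamma>(1) by (simp add: m_assoc flip: that(2))
    have small: "cut (\<lambda>d. d = \<one>) {\<one>, \<kappa>}"
      using \<kappa> by (intro cut_small) (auto simp: card_insert_if)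
    obtain B' n' where B'n': "\<And>F (\<sigma> :: nat \<Rightarrow> _). finite F \<Longrightarrow> F \<subseteq> carrier G \<Longrightarrow> n' \<le> card F \<Longrightarrow>
      (\<And>j. j \<in> {0::nat} \<Longrightarrow> \<sigma> j ` F \<subseteq> carrier G \<and> inj_on (\<sigma> j) F) \<Longrightarrow>
      (\<And>f i j. f \<in> F \<Longrightarrow> i \<in> {0::nat} \<Longrightarrow> j \<in> {0} \<Longrightarrow> i \<noteq> j \<Longrightarrow> \<sigma> j f \<notin> B' #> \<sigma> i f) \<Longrightarrow>
      \<exists>cut' K'. pliable G cut' K' \<and> (\<forall>x R. cut' x R \<longrightarrow> cut x R) \<and>
        (\<forall>z\<in>pliable.points G cut'. \<forall>h\<in>carrier G. \<exists>f\<in>F. \<forall>j\<in>{0}. \<forall>w\<in>{\<one>, \<kappa>}.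
          z (w \<otimes> (\<sigma> j f \<otimes> h)) = (w = \<one>))"
      by (rule ex_refinement[of "{0}" "\<lambda>_ d. d = \<one>" "\<lambda>_. {\<one>, \<kappa>}"]) (use small in auto)
    obtain T where T: "finite T" "card T = n'" "T \<subseteq> {t\<in>?A. ?c t = \<kappa>}"
      using infinite_arbitrarily_large[OF t0(2), folded \<kappa>_def] by blast
    have T_carrier: "T \<subseteq> carrier G" using T(3) by blast
    have "\<exists>cut' K'. pliable G cut' K' \<and> (\<forall>x R. cut' x R \<longrightarrow> cut x R) \<and>
        (\<forall>z\<in>pliable.points G cut'. \<forall>h\<in>carrier G. \<exists>f\<in>T. \<forall>j\<in>{0::nat}. \<forall>w\<in>{\<one>, \<kappa>}.
          z (w \<otimes> ((\<lambda>_ f. f) j f \<otimes> h)) = (w = \<one>))"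
      using T(1,2) T_carrier by (intro B'n') auto
    then obtain cut' K' where c: "pliable G cut' K'" "\<forall>x R. cut' x R \<longrightarrow> cut x R"
      and hit: "\<forall>z\<in>pliable.points G cut'. \<forall>h\<in>carrier G. \<exists>t\<in>T. \<forall>w\<in>{\<one>, \<kappa>}.
          z (w \<otimes> (t \<otimes> h)) = (w = \<one>)" by auto
    have "\<exists>t\<in>T. z (t \<otimes> (\<gamma> \<otimes> h)) \<noteq> z (t \<otimes> h)"
      if z: "z \<in> pliable.points G cut'" and h: "h \<in> carrier G" for z h
    proof -
      obtain t where t: "t \<in> T" "\<forall>w\<in>{\<one>, \<kappa>}. z (w \<otimes> (t \<otimes> h)) = (w = \<one>)"
        using bspec[OF bspec[OF hit z] h] by (elim bexE)
      have tc: "t \<in> carrier G" "?c t = \<kappa>" using t(1) T(3) by auto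
      have "\<kappa> \<otimes> (t \<otimes> h) = t \<otimes> (\<gamma> \<otimes> h)"
        using conj[OF tc] tc(1) \<kappa> \<gamma>(1) h by (simp flip: m_assoc)
      then have "z (t \<otimes> h)" "\<not> z (t \<otimes> (\<gamma> \<otimes> h))"
        using t(2) tc(1) h \<open>\<kappa> \<noteq> \<one>\<close> by auto
      then show ?thesis using t(1) by blast
    qed
    then have "\<exists>T. finite T \<and> T \<subseteq> carrier G \<and>
      (\<forall>z\<in>pliable.points G cut'. \<forall>h\<in>carrier G. \<exists>t\<in>T. z (t \<otimes> (\<gamma> \<otimes> h)) \<noteq> z (t \<otimes> h))"
      using T(1) T_carrier by (intro exI[of _ T]) simp
    note all = conjI[OF c(1) conjI[OF c(2) this]]
    show ?thesis by (rule exI[of _ cut'], rule exI[of _ K'], fact all)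
  qed
qed

end

section \<open>The limit of the refinements\<close>

context group
begin

lemma pliable_full_shift: "pliable G (\<lambda>x R. finite R \<and> R \<subseteq> carrier G) {\<one>}"
proof
  show "finite (R #> inv g) \<and> R #> inv g \<subseteq> carrier G"
    if "finite R \<and> R \<subseteq> carrier G" "g \<in> carrier G" for R g
    using that by (auto intro: finite_r_coset dest: r_coset_subset_G[THEN subsetD])
next
  fix \<I> :: "(('a \<Rightarrow> bool) \<times> 'a set) set"
  assume car: "\<forall>p\<in>\<I>. finite (snd p) \<and> snd p \<subseteq> carrier G" and sep: "separated {\<one>} \<I>"
  have one_mult: "{\<one>} <#> W = W" if "W \<subseteq> carrier G" for W
    using that by (auto simp: set_mult_def subset_iff)
  have same: "p = p'" if p: "p \<in> \<I>" "p' \<in> \<I>" and r: "r \<in> snd p" "r \<in> snd p'" for p p' r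
  proof (rule ccontr)
    assume "p \<noteq> p'"
    have "snd p \<inter> snd p' = {}"
      using separatedD[OF sep p \<open>p \<noteq> p'\<close>] car p by (simp add: one_mult)
    then show False using r by blast
  qed
  define x where "x r = fst (SOME p. p \<in> \<I> \<and> r \<in> snd p) r" for r
  have x: "x r = fst p r" if "p \<in> \<I>" "r \<in> snd p" for p r
  proof -
    have "(SOME p. p \<in> \<I> \<and> r \<in> snd p) = p"
      using that by (intro some_equality conjI same[of _ p r]) simp_all
    then show ?thesis by (simp add: x_def)
  qed
  have "\<exists>R. W \<subseteq> R \<and> R \<subseteq> {\<one>} <#> W \<and> finite R \<and> R \<subseteq> carrier G"
    if "finite W" "W \<subseteq> carrier G" for W
    using that one_mult by (intro exI[of _ W]) simp
  then show "\<exists>x. (\<forall>p\<in>\<I>. \<forall>r\<in>snd p. x r = fst p r) \<and>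
     (\<forall>W. finite W \<longrightarrow> W \<subseteq> carrier G \<longrightarrow> clean {\<one>} \<I> W \<longrightarrow>
        (\<exists>R. W \<subseteq> R \<and> R \<subseteq> {\<one>} <#> W \<and> finite R \<and> R \<subseteq> carrier G))"
    using x by (intro exI[of _ x]) simp
qed auto

lemma ex_decreasing_points:
  assumes step: "\<And>n cut K. pliable G cut K \<Longrightarrow>
    \<exists>cut' K'. pliable G cut' K' \<and> (\<forall>x R. cut' x R \<longrightarrow> cut x R) \<and> Q n (pliable.points G cut')"
  obtains X :: "nat \<Rightarrow> ('a \<Rightarrow> bool) set" where "\<And>n. X n \<noteq> {}" "\<And>n. Q n (X n)" "decseq X"
    "\<And>n x g. x \<in> X n \<Longrightarrow> g \<in> carrier G \<Longrightarrow> shift g x \<in> X n"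
proof -
  let ?A = "\<lambda>n (p :: (('a \<Rightarrow> bool) \<Rightarrow> 'a set \<Rightarrow> bool) \<times> 'a set).
    pliable G (fst p) (snd p) \<and> Q n (pliable.points G (fst p))"
  let ?R = "\<lambda>(p :: (('a \<Rightarrow> bool) \<Rightarrow> 'a set \<Rightarrow> bool) \<times> 'a set) (p' :: (('a \<Rightarrow> bool) \<Rightarrow> 'a set \<Rightarrow> bool) \<times> 'a set). \<forall>x R. fst p' x R \<longrightarrow> fst p x R"
  have "\<exists>s. \<forall>n. ?A n (s n) \<and> ?R (s n) (s (Suc n))"
  proof (rule dependent_nat_choice)
    obtain c K where "pliable G c K" "Q 0 (pliable.points G c)"
      using step[OF pliable_full_shift, of 0] by (elim exE conjE)
    then show "\<exists>p. ?A 0 p" by (intro exI[of _ "(c, K)"]) simp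
  next
    fix p n assume p: "?A n p"
    obtain c K where "pliable G c K" "\<forall>x R. c x R \<longrightarrow> fst p x R" "Q (Suc n) (pliable.points G c)"
      using step[OF conjunct1[OF p], of "Suc n"] by (elim exE conjE)
    then show "\<exists>p'. ?A (Suc n) p' \<and> ?R p p'" by (intro exI[of _ "(c, K)"]) simp
  qed
  then obtain s where s: "\<And>n. ?A n (s n)" "\<And>n. ?R (s n) (s (Suc n))" by blast
  show ?thesis
  proof (rule that[of "\<lambda>n. pliable.points G (fst (s n))"])
    fix n
    interpret pliable G "fst (s n)" "snd (s n)" by (rule conjunct1[OF s(1)])
    show "points \<noteq> {}" by (rule points_nonempty)
    show "Q n points" by (rule conjunct2[OF s(1)])
    show "shift g x \<in> points" if "x \<in> points" "g \<in> carrier G" for x g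
      by (rule points_shift[OF that])
  next
    show "decseq (\<lambda>n. pliable.points G (fst (s n)))"
    proof (rule decseq_SucI)
      fix n
      have points: "pliable.points G (fst (s n)) =
          {x. \<forall>W. finite W \<longrightarrow> W \<subseteq> carrier G \<longrightarrow> (\<exists>R. W \<subseteq> R \<and> fst (s n) x R)}" for n
        by (rule pliable.points_def[OF conjunct1[OF s(1)]])
      show "pliable.points G (fst (s (Suc n))) \<subseteq> pliable.points G (fst (s n))"
        unfolding points using s(2)[of n] by (intro Collect_mono) metis
    qed
  qed
qed

end

lemma topspace_shift_space: "topspace (shift_space G) = (carrier G \<rightarrow>\<^sub>E UNIV)"
  by (simp add: shift_space_def)

text \<open>The points of a pliable family are arbitrary outside the carrier, while those of the shift space
  are extensional; restriction to the carrier translates between the two.\<close>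
lemma closure_of_shift_space_approx:
  assumes y: "y \<in> shift_space G closure_of ((\<lambda>x. restrict x (carrier G)) ` X)"
    and W: "finite W" "W \<subseteq> carrier G"
  shows "\<exists>x\<in>X. \<forall>w\<in>W. x w = y w"
proof -
  let ?V = "\<Pi>\<^sub>E i\<in>carrier G. (if i \<in> W then {y i} else UNIV)"
  have "openin (shift_space G) ?V"
    unfolding shift_space_def
    using W by (intro openin_PiE_gen[THEN iffD2] disjI2 conjI)
      (auto intro: finite_subset[of _ W])
  moreover have "y \<in> carrier G \<rightarrow>\<^sub>E UNIV"
    using y closure_of_subset_topspace[of "shift_space G"] unfolding topspace_shift_space by blast
  then have "y \<in> ?V" by (simp add: PiE_iff)
  ultimately have "\<exists>z. z \<in> (\<lambda>x. restrict x (carrier G)) ` X \<and> z \<in> ?V"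
    using y unfolding in_closure_of by blast
  then obtain x where x: "x \<in> X" "restrict x (carrier G) \<in> ?V" by blast
  have "x w = y w" if "w \<in> W" for w
    using PiE_mem[OF x(2), of w] that W(2) by auto
  then show ?thesis using x(1) by blast
qed

lemma openin_shift_space_window:
  assumes "openin (shift_space G) V" "y \<in> V"
  obtains W where "finite W" "W \<subseteq> carrier G"
    "\<And>z. z \<in> topspace (shift_space G) \<Longrightarrow> (\<And>w. w \<in> W \<Longrightarrow> z w = y w) \<Longrightarrow> z \<in> V"
proof -
  obtain U where U: "finite {i\<in>carrier G. U i \<noteq> UNIV}" "y \<in> PiE (carrier G) U" "PiE (carrier G) U \<subseteq> V"
    using assms unfolding shift_space_def openin_product_topology_alt by auto
  show ?thesis
  proof (rule that[OF U(1)])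
    fix z assume z: "z \<in> topspace (shift_space G)" "\<And>w. w \<in> {i\<in>carrier G. U i \<noteq> UNIV} \<Longrightarrow> z w = y w"
    have "z i \<in> U i" if i: "i \<in> carrier G" for i
    proof (cases "U i = UNIV")
      case False
      then have "z i = y i" using z(2) i by blast
      then show ?thesis using PiE_mem[OF U(2) i] by simp
    qed simp
    then have "z \<in> PiE (carrier G) U" using z(1) unfolding topspace_shift_space by (auto simp: PiE_iff)
    then show "z \<in> V" using U(3) by blast
  qed auto
qed

theorem corollary1p11:
  fixes G :: "('g, 'm) monoid_scheme"
    and \<F> :: "nat \<Rightarrow> 'g set set"
  assumes "group G" and "countable (carrier G)" and "infinite (carrier G)"
    and "\<And>n F. F \<in> \<F> n \<Longrightarrow> finite F \<and> F \<subseteq> carrier G"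
    and "\<And>n. unbounded_family (\<F> n)"
  shows "\<exists>Y. subflow G (shift_space G) (shift_action G) Y \<and>
             free_flow G (subtopology (shift_space G) Y) (restrict_action (shift_action G) Y) \<and>
             (\<forall>n. family_minimal G (subtopology (shift_space G) Y)
                    (restrict_action (shift_action G) Y) (\<F> n))"
proof -
  interpret group G by (fact assms(1))
  let ?E = "topspace (shift_space G)"
  let ?r = "\<lambda>x. restrict x (carrier G)"
  let ?Fin = "{W. finite W \<and> W \<subseteq> carrier G}"
  define aperiodic where "aperiodic \<gamma> X \<longleftrightarrow> \<gamma> \<noteq> \<one>\<^bsub>G\<^esub> \<longrightarrow> (\<exists>T. finite T \<and> T \<subseteq> carrier G \<and>
    (\<forall>z\<in>X. \<forall>h\<in>carrier G. \<exists>t\<in>T. z (t \<otimes>\<^bsub>G\<^esub> (\<gamma> \<otimes>\<^bsub>G\<^esub> h)) \<noteq> z (t \<otimes>\<^bsub>G\<^esub> h)))"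
    for \<gamma> and X :: "('g \<Rightarrow> bool) set"
  define recurrent where "recurrent n W S X \<longleftrightarrow> (\<exists>x\<in>X. \<forall>w\<in>W. x w = (w \<in> S)) \<longrightarrow>
    (\<exists>F\<in>\<F> n. \<forall>z\<in>X. \<forall>h\<in>carrier G. \<exists>f\<in>F. \<forall>w\<in>W. z (w \<otimes>\<^bsub>G\<^esub> (f \<otimes>\<^bsub>G\<^esub> h)) = (w \<in> S))"
    for n W S and X :: "('g \<Rightarrow> bool) set"
  define task where "task r = (case r of Inl \<gamma> \<Rightarrow> aperiodic \<gamma> | Inr (n, W, S) \<Rightarrow> recurrent n W S)"
    for r :: "'g + nat \<times> 'g set \<times> 'g set"
  \<comment> \<open>A pattern on \<open>W\<close> is given by the set \<open>S\<close> of the places where it is true.\<close>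
  let ?Tasks = "carrier G <+> (UNIV :: nat set) \<times> ?Fin \<times> ?Fin"
  have "countable ?Fin"
    using countable_Collect_finite_subset[OF assms(2)] by (simp add: conj_commute)
  then have count: "countable ?Tasks" using assms(2) by (intro countable_Plus countable_SIGMA) auto
  have ne: "?Tasks \<noteq> {}" by blast
  have step: "\<exists>cut' K'. pliable G cut' K' \<and> (\<forall>x R. cut' x R \<longrightarrow> cut x R) \<and> task r (pliable.points G cut')"
    if r: "r \<in> ?Tasks" and "pliable G cut K" for r cut K
  proof -
    interpret pliable G cut K by fact
    have stay: ?thesis if "task r points"
      using that by (intro exI[of _ cut] exI[of _ K] conjI pliable_axioms) auto
    from r show ?thesis
    proof (rule PlusE)
      fix \<gamma> assume \<gamma>: "\<gamma> \<in> carrier G" "r = Inl \<gamma>"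
      show ?thesis
      proof (cases "\<gamma> = \<one>\<^bsub>G\<^esub>")
        case True
        then show ?thesis using \<gamma>(2) by (intro stay) (simp add: task_def aperiodic_def)
      next
        case False
        show ?thesis
          using ex_refinement_free[OF assms(3) \<gamma>(1) False] unfolding \<gamma>(2) task_def aperiodic_def sum.case
          by (simp only: False not_False_eq_True True_implies_equals simp_thms)
      qed
    next
      fix p assume p: "p \<in> (UNIV :: nat set) \<times> ?Fin \<times> ?Fin" "r = Inr p"
      obtain n W S where nWS: "p = (n, W, S)" using prod_cases3 by blast
      have W: "finite W" "W \<subseteq> carrier G" using p(1) nWS by auto
      have task: "task r = recurrent n W S" by (simp add: task_def p(2) nWS)
      show ?thesis
      proof (cases "\<exists>x\<in>points. \<forall>w\<in>W. x w = (w \<in> S)")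
        case False
        then show ?thesis by (intro stay) (simp only: task recurrent_def simp_thms)
      next
        case True
        then obtain x where x: "x \<in> points" "\<forall>w\<in>W. x w = (w \<in> S)" by blast
        have "\<exists>cut' K'. pliable G cut' K' \<and> (\<forall>x R. cut' x R \<longrightarrow> cut x R) \<and>
          (\<exists>F\<in>\<F> n. \<forall>z\<in>pliable.points G cut'. \<forall>h\<in>carrier G. \<exists>f\<in>F. \<forall>w\<in>W.
            z (w \<otimes>\<^bsub>G\<^esub> (f \<otimes>\<^bsub>G\<^esub> h)) = x w)"
          using assms(4,5) by (intro ex_refinement_syndetic[OF x(1) W])
        then obtain cut' K' F where c: "pliable G cut' K'" "\<forall>x R. cut' x R \<longrightarrow> cut x R" and F: "F \<in> \<F> n"
          and hit: "\<forall>z\<in>pliable.points G cut'. \<forall>h\<in>carrier G. \<exists>f\<in>F. \<forall>w\<in>W. z (w \<otimes>\<^bsub>G\<^esub> (f \<otimes>\<^bsub>G\<^esub> h)) = x w"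
          by (elim exE conjE bexE)
        have "\<exists>f\<in>F. \<forall>w\<in>W. z (w \<otimes>\<^bsub>G\<^esub> (f \<otimes>\<^bsub>G\<^esub> h)) = (w \<in> S)"
          if "z \<in> pliable.points G cut'" "h \<in> carrier G" for z h
          using bspec[OF bspec[OF hit that(1)] that(2)] x(2) by simp
        then have "task r (pliable.points G cut')" unfolding task recurrent_def using F by blast
        then show ?thesis by (intro exI[of _ cut'] exI[of _ K'] conjI c)
      qed
    qed
  qed
  obtain X where X_ne: "\<And>n. X n \<noteq> {}" and X_task: "\<And>n. task (from_nat_into ?Tasks n) (X n)"
    and X_dec: "decseq X" and X_shift: "\<And>n x g. x \<in> X n \<Longrightarrow> g \<in> carrier G \<Longrightarrow> shift g x \<in> X n"
  proof (rule ex_decreasing_points[of "\<lambda>n. task (from_nat_into ?Tasks n)"])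
    show "\<exists>cut' K'. pliable G cut' K' \<and> (\<forall>x R. cut' x R \<longrightarrow> cut x R) \<and>
        task (from_nat_into ?Tasks n) (pliable.points G cut')" if "pliable G cut K" for n cut K
      by (rule step[OF from_nat_into[OF ne] that])
  qed (rule that; assumption)
  have X_task': "\<exists>n. task r (X n)" if r: "r \<in> ?Tasks" for r
  proof -
    obtain n where "from_nat_into ?Tasks n = r" using from_nat_into_surj[OF count r] by (elim exE)
    then have "task r (X n)" using X_task[of n] by (simp only:)
    then show ?thesis by (rule exI)
  qed
  define C where "C n = shift_space G closure_of (?r ` X n)" for n
  define Y where "Y = (\<Inter>n. C n)"
  have flow: "flow G (shift_space G) (shift_action G)" by (rule flow_shift[OF assms(1)])
  have Y_E: "Y \<subseteq> ?E" unfolding Y_def C_def using closure_of_subset_topspace by fast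
  have approx: "\<exists>x\<in>X n. \<forall>w\<in>W. x w = y w" if "y \<in> Y" "finite W" "W \<subseteq> carrier G" for y n W
    using that closure_of_shift_space_approx[of y G "X n" W] unfolding Y_def C_def by blast
  have Y_ne: "Y \<noteq> {}"
    unfolding Y_def
  proof (rule compact_space_imp_nest)
    show "compact_space (shift_space G)" using flow by (simp add: flow_def)
    show "closedin (shift_space G) (C n)" for n unfolding C_def by simp
    have sub: "?r ` X n \<subseteq> ?E" for n unfolding topspace_shift_space by auto
    show "C n \<noteq> {}" for n using closure_of_subset[OF sub[of n]] X_ne[of n] unfolding C_def by blast
    show "decseq C" unfolding C_def decseq_def
      using X_dec by (auto simp: decseq_def intro!: closure_of_mono image_mono)
  qed
  have action: "shift_action G \<gamma> y = (\<lambda>d\<in>carrier G. y (d \<otimes>\<^bsub>G\<^esub> \<gamma>))" if "y \<in> ?E" for \<gamma> y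
    using that by (simp add: shift_action_def)
  have Y_inv: "shift_action G \<gamma> ` Y \<subseteq> Y" if \<gamma>: "\<gamma> \<in> carrier G" for \<gamma>
  proof -
    have "shift_action G \<gamma> ` C n \<subseteq> C n" for n
    proof -
      have "shift_action G \<gamma> ` (?r ` X n) \<subseteq> ?r ` X n"
      proof clarify
        fix x assume x: "x \<in> X n"
        have "shift_action G \<gamma> (?r x) = ?r (shift \<gamma> x)"
          using \<gamma> by (subst action) (auto simp: topspace_shift_space shift_def restrict_def)
        then show "shift_action G \<gamma> (?r x) \<in> ?r ` X n" using X_shift[OF x \<gamma>] by simp
      qed
      then show ?thesis
        unfolding C_def
        using continuous_map_image_closure_subset[OF flow_continuous[OF flow \<gamma>], of "?r ` X n"] closure_of_mono
        by (meson order.trans)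
    qed
    then show ?thesis unfolding Y_def by blast
  qed
  have sub: "subflow G (shift_space G) (shift_action G) Y"
    unfolding subflow_def using flow Y_ne Y_inv by (auto simp: Y_def C_def)
  have flow_Y: "flow G (subtopology (shift_space G) Y) (restrict_action (shift_action G) Y)"
    by (rule flow_subflow[OF sub])
  have top_Y: "topspace (subtopology (shift_space G) Y) = Y"
    using Y_E by (rule topspace_subtopology_subset)
  have "free_flow G (subtopology (shift_space G) Y) (restrict_action (shift_action G) Y)"
    unfolding free_flow_def top_Y
  proof (intro conjI ballI impI flow_Y notI)
    fix y \<gamma> assume y: "y \<in> Y" and \<gamma>: "\<gamma> \<in> carrier G" "\<gamma> \<noteq> \<one>\<^bsub>G\<^esub>"
      and fix_y: "restrict (shift_action G \<gamma>) Y y = y"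
    obtain n where "aperiodic \<gamma> (X n)" using X_task'[of "Inl \<gamma>"] \<gamma>(1) by (auto simp: task_def)
    then obtain T where T: "finite T" "T \<subseteq> carrier G"
      and move: "\<forall>z\<in>X n. \<forall>h\<in>carrier G. \<exists>t\<in>T. z (t \<otimes>\<^bsub>G\<^esub> (\<gamma> \<otimes>\<^bsub>G\<^esub> h)) \<noteq> z (t \<otimes>\<^bsub>G\<^esub> h)"
      using \<gamma>(2) unfolding aperiodic_def by blast
    have "finite (T \<union> (T #>\<^bsub>G\<^esub> \<gamma>))" using T(1) by (auto intro: finite_r_coset)
    then obtain x where x: "x \<in> X n" "\<forall>w\<in>T \<union> (T #>\<^bsub>G\<^esub> \<gamma>). x w = y w"
      using approx[OF y, of "T \<union> (T #>\<^bsub>G\<^esub> \<gamma>)" n] r_coset_subset_G[OF T(2) \<gamma>(1)] T(2) by blast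
    obtain t where t: "t \<in> T" "x (t \<otimes>\<^bsub>G\<^esub> (\<gamma> \<otimes>\<^bsub>G\<^esub> \<one>\<^bsub>G\<^esub>)) \<noteq> x (t \<otimes>\<^bsub>G\<^esub> \<one>\<^bsub>G\<^esub>)"
      using bspec[OF bspec[OF move x(1)] one_closed] by blast
    have tc: "t \<in> carrier G" using t(1) T(2) by blast
    have "y (t \<otimes>\<^bsub>G\<^esub> \<gamma>) = y t"
      using fix_y y action[of y \<gamma>] Y_E tc by (metis restrict_apply' subsetD)
    then show False using t x(2) tc \<gamma>(1) in_r_coset[OF t(1), of \<gamma>] by auto
  qed
  moreover have "family_minimal G (subtopology (shift_space G) Y)
      (restrict_action (shift_action G) Y) (\<F> n)" for n
    unfolding family_minimal_def top_Y
  proof (intro conjI allI impI flow_Y)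
    fix V assume "openin (subtopology (shift_space G) Y) V \<and> V \<noteq> {}"
    then obtain V' y0 where V: "openin (shift_space G) V'" "V = V' \<inter> Y" "y0 \<in> V"
      unfolding openin_subtopology by blast
    obtain W where W: "finite W" "W \<subseteq> carrier G"
      "\<And>z. z \<in> ?E \<Longrightarrow> (\<And>w. w \<in> W \<Longrightarrow> z w = y0 w) \<Longrightarrow> z \<in> V'"
      using openin_shift_space_window[OF V(1), of y0] V(2,3) by blast
    let ?S = "{w\<in>W. y0 w}"
    have "Inr (n, W, ?S) \<in> ?Tasks" using W(1,2) by auto
    from X_task'[OF this] obtain k where "recurrent n W ?S (X k)" by (auto simp: task_def)
    moreover have "\<exists>x\<in>X k. \<forall>w\<in>W. x w = (w \<in> ?S)"
      using approx[of y0 W k] V(2,3) W(1,2) by auto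
    ultimately obtain F where F: "F \<in> \<F> n"
      and hit: "\<forall>z\<in>X k. \<forall>h\<in>carrier G. \<exists>f\<in>F. \<forall>w\<in>W. z (w \<otimes>\<^bsub>G\<^esub> (f \<otimes>\<^bsub>G\<^esub> h)) = (w \<in> ?S)"
      unfolding recurrent_def by blast
    have F_car: "finite F" "F \<subseteq> carrier G" using assms(4)[OF F] by auto
    have "y \<in> (\<Union>\<gamma>\<in>F. restrict (shift_action G (inv\<^bsub>G\<^esub> \<gamma>)) Y ` V)" if y: "y \<in> Y" for y
    proof -
      have yE: "y \<in> ?E" using y Y_E by blast
      have "finite (W <#>\<^bsub>G\<^esub> F)" "W <#>\<^bsub>G\<^esub> F \<subseteq> carrier G"
        using W F_car by (auto intro: finite_set_mult dest: set_mult_closed[THEN subsetD])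
      then obtain x where x: "x \<in> X k" "\<forall>v\<in>W <#>\<^bsub>G\<^esub> F. x v = y v" using approx[OF y] by blast
      obtain f where f: "f \<in> F" "\<forall>w\<in>W. x (w \<otimes>\<^bsub>G\<^esub> (f \<otimes>\<^bsub>G\<^esub> \<one>\<^bsub>G\<^esub>)) = (w \<in> ?S)"
        using bspec[OF bspec[OF hit x(1)] one_closed] by blast
      have fc: "f \<in> carrier G" using f(1) F_car(2) by blast
      let ?z = "shift_action G f y"
      have zY: "?z \<in> Y" using Y_inv[OF fc] y by blast
      have "?z w = y0 w" if w: "w \<in> W" for w
      proof -
        have wc: "w \<in> carrier G" using w W(2) by blast
        have "?z w = y (w \<otimes>\<^bsub>G\<^esub> f)" using action[OF yE, of f] wc by simp
        also have "\<dots> = x (w \<otimes>\<^bsub>G\<^esub> f)" using x(2) in_set_mult[OF w f(1)] by simp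
        also have "\<dots> = y0 w" using f(2) w fc by simp
        finally show ?thesis .
      qed
      then have "?z \<in> V" using W(3)[of ?z] zY Y_E V(2) by blast
      moreover have "shift_action G (inv\<^bsub>G\<^esub> f) ?z = y"
      proof -
        interpret group_action G ?E "shift_action G" using flow by (simp add: flow_def)
        show ?thesis using orbit_sym_aux[OF fc yE refl] .
      qed
      ultimately have "y \<in> restrict (shift_action G (inv\<^bsub>G\<^esub> f)) Y ` V"
        using zY by (intro image_eqI[of _ _ ?z]) auto
      then show ?thesis using f(1) by blast
    qed
    moreover have "restrict (shift_action G (inv\<^bsub>G\<^esub> \<gamma>)) Y ` V \<subseteq> Y" if "\<gamma> \<in> F" for \<gamma>
      using Y_inv[of "inv\<^bsub>G\<^esub> \<gamma>"] V(2) that F_car(2) by (auto simp: image_subset_iff)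
    ultimately have "syndetic G Y (restrict_action (shift_action G) Y) F V"
      unfolding syndetic_def by blast
    then show "\<exists>F\<in>\<F> n. syndetic G Y (restrict_action (shift_action G) Y) F V" using F by blast
  qed
  ultimately show ?thesis using sub by blast
qed

end
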